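(* Let $\Psi(\theta)=\frac1N\sum_{i=1}^N\psi_i(\theta)$ with $\psi_i(\theta)=\ell(f(x_i,\theta),y_i)$, where $f(x_i,\cdot):\mathbb{R}^n\to\mathbb{R}^m$ and $\ell$ are twice differentiable. Write $f^i(\theta)=f(x_i,\theta)$, $f^i_j$ for its $j$-th component, $J_f^i(\theta)=\nabla_\theta f(x_i,\theta)\in\mathbb{R}^{n\times m}$, $\ell_i(\theta)=\ell(f^i(\theta),y_i)$ with $\nabla_f\ell_i$, $\nabla_f^2\ell_i$ its gradient and Hessian with respect to the output $f$, and $$H_i(\theta)=J_f^i(\theta)\nabla_f^2\ell_i(\theta)J_f^i(\theta)^\top,\qquad \Pi_i(\theta)=\sum_{j=1}^m\nabla_{f_j}\ell_i(\theta)\nabla^2_\theta f^i_j(\theta),$$ so that $\nabla^2\Psi=\frac1N\sum_i(H_i+\Pi_i)$. Consider the iteration $$\theta_{k+1}=\theta_k-B_k^{-1}\nabla\Psi(\theta_k),\qquad B_k=H_{\mathcal S_H^k}(\theta_k)+\Lambda_k,\quad H_{\mathcal S_H^k}=\frac{1}{|\mathcal S_H^k|}\sum_{i\in\mathcal S_H^k}H_i,$$ where $\mathcal S_H^k\subseteq\{1,\dots,N\}$ are random sample sets and $\Lambda_k$ is generated by the BFGS update $\Lambda_k=\Lambda_{k-1}-\frac{\Lambda_{k-1}u_{k-1}u_{k-1}^\top\Lambda_{k-1}}{u_{k-1}^\top\Lambda_{k-1}u_{k-1}}+\frac{v_{k-1}v_{k-1}^\top}{u_{k-1}^\top v_{k-1}}$,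 so that $\Lambda_ku_{k-1}=v_{k-1}$, with $u_{k-1}=\theta_k-\theta_{k-1}$ and $v_{k-1}=\frac{1}{|\mathcal S_H^{k-1}|}\sum_{i\in\mathcal S_H^{k-1}}\big(J_f^i(\theta_k)-J_f^i(\theta_{k-1})\big)\nabla_f\ell_i(\theta_k)$. Assume: (a) almost surely $\sum_k\|\theta_k-\theta^*\|<\infty$ for an optimal point $\theta^*$ at which $\nabla^2\Psi(\theta^* )$ is positive definite, and there exists $\tilde\lambda>0$ with $\Pi_i(\theta^* )\succeq\tilde\lambda I$ for $i=1,\dots,N$; (b) there are constants $\kappa_\ell,\tilde\kappa_\ell,L_\ell$ such that for all $i$ and all $\theta,\theta_1,\theta_2$ near $\theta^*$: $\|\nabla_f\ell_i(\theta)\|\le\kappa_\ell$, $\|\nabla_f^2\ell_i(\theta)\|\le\tilde\kappa_\ell$, and $\|\nabla_f^2\ell_i(\theta_1)-\nabla_f^2\ell_i(\theta_2)\|\le L_\ell\|\theta_1-\theta_2\|$; (c) there are constants $\kappa_f,\tilde\kappa_f,L_f$ such that for all $i$, all $j=1,\dots,m$ and all $\theta,\theta_1,\theta_2$ near $\theta^*$: $\|\nabla f^i_j(\theta)\|\le\kappa_f$, $\|\nabla^2f^i_j(\theta)\|\le\tilde\kappa_f$, and $\|\nabla^2f^i_j(\theta_1)-\nabla^2f^i_j(\theta_2)\|\le L_f\|\theta_1-\theta_2\|$. If the sample size $|\mathcal S_H^k|$ increases superlinearly, then the sequence $\{\theta_k\}$ converges to $\theta^*$ superlinearly almost surely.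
   Context: $(x_i,y_i)$, $i=1,\dots,N$, are data points, $f(x_i,\theta)$ is a model output and $\ell$ a loss function. $H_i$ is the generalized Gauss–Newton part and $\Pi_i$ the remaining part of the Hessian of $\psi_i$.
   Formalization: The initial matrix Λ_0 is assumed symmetric positive definite (the claim fails for singular Λ_0), all B_k are invertible and BFGS denominators nonzero, and, as samples lie in {1,…,N}, "increases superlinearly" means at least min(N, s_k) with s_k/k → ∞. *)

theory Defs
  imports "HOL-Probability.Probability" "HOL-Library.Landau_Symbols"
begin

definition grad :: "(real^'n \<Rightarrow> real) \<Rightarrow> real^'n \<Rightarrow> real^'n" where
  "grad g x = (\<chi> a. frechet_derivative g (at x) (axis a 1))"

definition hess :: "(real^'n \<Rightarrow> real) \<Rightarrow> real^'n \<Rightarrow> real^'n^'n" where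
  "hess g x = (\<chi> a b. frechet_derivative (\<lambda>z. grad g z $ b) (at x) (axis a 1))"

definition twice_differentiable :: "(real^'n \<Rightarrow> real) \<Rightarrow> bool" where
  "twice_differentiable g \<longleftrightarrow>
     (\<forall>x. g differentiable (at x)) \<and> (\<forall>x. grad g differentiable (at x))"

text \<open>Jacobian in the paper's convention: an n x m matrix whose j-th column is the
  gradient of the j-th output component.\<close>
definition jac :: "(real^'n \<Rightarrow> real^'m) \<Rightarrow> real^'n \<Rightarrow> real^'m^'n" where
  "jac F t = (\<chi> a j. grad (\<lambda>s. F s $ j) t $ a)"

definition outer :: "real^'n \<Rightarrow> real^'m \<Rightarrow> real^'m^'n" where
  "outer x z = (\<chi> a b. x $ a * z $ b)"

definition pos_def :: "real^'n^'n \<Rightarrow> bool" where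
  "pos_def A \<longleftrightarrow> (\<forall>x. x \<noteq> 0 \<longrightarrow> 0 < x \<bullet> (A *v x))"

definition loewner_ge :: "real^'n^'n \<Rightarrow> real^'n^'n \<Rightarrow> bool" where
  "loewner_ge A B \<longleftrightarrow> (\<forall>x. 0 \<le> x \<bullet> ((A - B) *v x))"

text \<open>Generalized Gauss-Newton part H_i and remaining part Pi_i of the Hessian of
  psi_i = L o F, where F = f(x_i,.) and L = l(., y_i).\<close>
definition gn_part :: "(real^'n \<Rightarrow> real^'m) \<Rightarrow> (real^'m \<Rightarrow> real) \<Rightarrow> real^'n \<Rightarrow> real^'n^'n" where
  "gn_part F L t = jac F t ** hess L (F t) ** transpose (jac F t)"

definition res_part :: "(real^'n \<Rightarrow> real^'m) \<Rightarrow> (real^'m \<Rightarrow> real) \<Rightarrow> real^'n \<Rightarrow> real^'n^'n" where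
  "res_part F L t = (\<Sum>j\<in>UNIV. grad L (F t) $ j *\<^sub>R hess (\<lambda>s. F s $ j) t)"

definition sloss :: "(real^'m \<Rightarrow> 'y \<Rightarrow> real) \<Rightarrow> (nat \<Rightarrow> 'y) \<Rightarrow> nat \<Rightarrow> real^'m \<Rightarrow> real" where
  "sloss ell y i = (\<lambda>z. ell z (y i))"

definition objective :: "nat \<Rightarrow> (nat \<Rightarrow> real^'n \<Rightarrow> real^'m) \<Rightarrow> (real^'m \<Rightarrow> 'y \<Rightarrow> real)
    \<Rightarrow> (nat \<Rightarrow> 'y) \<Rightarrow> real^'n \<Rightarrow> real" where
  "objective N f ell y t = (1 / real N) * (\<Sum>i\<in>{1..N}. ell (f i t) (y i))"

definition sub_ggn :: "nat set \<Rightarrow> (nat \<Rightarrow> real^'n \<Rightarrow> real^'m) \<Rightarrow> (real^'m \<Rightarrow> 'y \<Rightarrow> real)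
    \<Rightarrow> (nat \<Rightarrow> 'y) \<Rightarrow> real^'n \<Rightarrow> real^'n^'n" where
  "sub_ggn S f ell y t = (1 / real (card S)) *\<^sub>R (\<Sum>i\<in>S. gn_part (f i) (sloss ell y i) t)"

definition secant_v :: "nat set \<Rightarrow> (nat \<Rightarrow> real^'n \<Rightarrow> real^'m) \<Rightarrow> (real^'m \<Rightarrow> 'y \<Rightarrow> real)
    \<Rightarrow> (nat \<Rightarrow> 'y) \<Rightarrow> real^'n \<Rightarrow> real^'n \<Rightarrow> real^'n" where
  "secant_v S f ell y t_old t_new = (1 / real (card S)) *\<^sub>R
     (\<Sum>i\<in>S. (jac (f i) t_new - jac (f i) t_old) *v grad (sloss ell y i) (f i t_new))"

end

theory Submission
  imports Defs
begin

text \<open>Since the sample sizes eventually reach \<open>N\<close>, only finitely many steps are subsampled. Let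
  \<open>\<Pi>\<close> be the averaged residual part at \<open>\<theta>\<^sup>*\<close>, \<open>G\<close> the Hessian there and \<open>e\<close>, \<open>u\<close>
  the error and the step. A congruence reduces everything to \<open>\<Pi> = I\<close>; then
  \<open>E = \<Lambda>\<^sup>-\<^sup>1 - I\<close> is updated to \<open>P E P\<close> up to a summable relative error, with
  \<open>P\<close> the orthogonal projection off \<open>u\<close>. In Frobenius norm this makes \<open>E\<close> bounded and
  \<open>\<bar>E u\<bar>\<^sup>2 / \<bar>u\<bar>\<^sup>2\<close> summable.

  The usual theory then needs \<open>\<Lambda>\<close> to be bounded, but the early updates may have destroyed its
  positive definiteness. Instead, put \<open>g' = G e'\<close> with \<open>e'\<close> the next error. The iteration gives
  \<open>(I + E) g' = E u\<close> up to small terms, so if \<open>\<bar>g'\<bar> \<ge> \<delta> \<bar>u\<bar>\<close>, then \<open>g'\<close> is almost an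
  eigenvector of \<open>E\<close> for \<open>-1\<close>, hence almost orthogonal to the next step, which is almost in the
  kernel of \<open>E\<close>. So the energy \<open>e \<bullet> G e\<close> cannot decrease by more than a summable factor, and it
  grows by the energy of the next step, so that the next step is of the same kind. One such late step
  would therefore keep the errors away from \<open>0\<close>.\<close>

subsection \<open>Frobenius norm and orthogonal projections\<close>

lemma sum_matrix_vector_mult: "(\<Sum>i\<in>S. A i) *v x = (\<Sum>i\<in>S. A i *v (x :: real^'n))"
  by (induction S rule: infinite_finite_induct) (simp_all add: matrix_vector_mult_add_rdistrib)

lemma matrix_vector_mult_minus: "A *v (- x) = - (A *v (x :: real^'n))"
  using matrix_vector_mult_diff_distrib[of A 0 x] by simp

text \<open>\<open>norm\<close> on nested vectors is the Frobenius norm. The matrix estimates below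
  use it because its square splits into rows and therefore records exactly what a projection
  removes.\<close>

lemma power2_norm_matrix:
  fixes A :: "real^'n^'m"
  shows "(norm A)\<^sup>2 = (\<Sum>i\<in>UNIV. (norm (A $ i))\<^sup>2)"
  by (simp add: power2_norm_eq_inner inner_vec_def)

lemma power2_norm_matrix_vector_mult:
  fixes A :: "real^'n^'m"
  shows "(norm (A *v x))\<^sup>2 = (\<Sum>i\<in>UNIV. (A $ i \<bullet> x)\<^sup>2)"
  unfolding power2_norm_eq_inner inner_vec_def[of "A *v x"] matrix_vector_mul_component
  by (simp add: power2_eq_square)

lemma norm_matrix_vector_mult_le:
  fixes A :: "real^'n^'m"
  shows "norm (A *v x) \<le> norm A * norm x"
proof -
  have "(norm (A *v x))\<^sup>2 = (\<Sum>i\<in>UNIV. (A $ i \<bullet> x)\<^sup>2)"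
    by (rule power2_norm_matrix_vector_mult)
  also have "\<dots> \<le> (\<Sum>i\<in>UNIV. (norm (A $ i) * norm x)\<^sup>2)"
  proof (rule sum_mono)
    show "(A $ i \<bullet> x)\<^sup>2 \<le> (norm (A $ i) * norm x)\<^sup>2" for i
      using power_mono[OF Cauchy_Schwarz_ineq2[of "A $ i" x] abs_ge_zero, of 2] by simp
  qed
  also have "\<dots> = (norm A * norm x)\<^sup>2"
    by (simp add: power_mult_distrib power2_norm_matrix sum_distrib_right)
  finally show ?thesis
    by (rule power2_le_imp_le) simp
qed

lemma norm_transpose:
  fixes A :: "real^'n^'m"
  shows "norm (transpose A) = norm A"
proof -
  have "(norm (transpose A))\<^sup>2 = (norm A)\<^sup>2"
    unfolding power2_norm_eq_inner inner_vec_def transpose_def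
    by simp (rule sum.swap)
  then show ?thesis by simp
qed

lemma norm_matrix_matrix_mult_le:
  fixes A :: "real^'n^'m" and B :: "real^'k^'n"
  shows "norm (A ** B) \<le> norm A * norm B"
proof -
  have "(A ** B) $ i = transpose B *v (A $ i)" for i
    by (simp add: vec_eq_iff matrix_matrix_mult_def matrix_vector_mult_def transpose_def mult.commute)
  then have "(norm (A ** B))\<^sup>2 = (\<Sum>i\<in>UNIV. (norm (transpose B *v (A $ i)))\<^sup>2)"
    by (simp add: power2_norm_matrix)
  also have "\<dots> \<le> (\<Sum>i\<in>UNIV. (norm B * norm (A $ i))\<^sup>2)"
    using norm_matrix_vector_mult_le[of "transpose B"] norm_transpose[of B]
    by (intro sum_mono power_mono) auto
  also have "\<dots> = (norm A * norm B)\<^sup>2"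
    unfolding power_mult_distrib power2_norm_matrix[of A] by (simp add: sum_distrib_left mult.commute)
  finally show ?thesis
    by (rule power2_le_imp_le) simp
qed

lemma outer_mult_vector: "outer x z *v w = (z \<bullet> w) *\<^sub>R x"
  by (simp add: vec_eq_iff outer_def matrix_vector_mult_def inner_vec_def sum_distrib_left
      sum_distrib_right mult.assoc mult.commute mult.left_commute)

lemma transpose_outer: "transpose (outer x z) = outer z x"
  by (simp add: vec_eq_iff outer_def transpose_def mult.commute)

lemma norm_outer: "norm (outer x z) = norm x * norm z"
proof -
  have "outer x z $ i = x $ i *\<^sub>R z" for i
    by (simp add: vec_eq_iff outer_def)
  then have "(norm (outer x z))\<^sup>2 = (norm x * norm z)\<^sup>2"
    by (simp add: power2_norm_matrix power_mult_distrib sum_distrib_right power2_norm_eq_inner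
        inner_vec_def flip: power2_eq_square)
  then show ?thesis by simp
qed

lemma transpose_diff: "transpose (A - B :: real^'n^'m) = transpose A - transpose B"
  and transpose_add: "transpose (A + B :: real^'n^'m) = transpose A + transpose B"
  and transpose_scaleR: "transpose (c *\<^sub>R A :: real^'n^'m) = c *\<^sub>R transpose A"
  by (simp_all add: vec_eq_iff transpose_def)

lemma symmetric_matrix_inner:
  assumes "transpose A = (A :: real^'n^'n)"
  shows "x \<bullet> (A *v z) = (A *v x) \<bullet> z"
  by (metis assms dot_lmul_matrix transpose_matrix_vector)

lemma transpose_mult_inner: "x \<bullet> (transpose T *v (y::real^'n)) = (T *v x) \<bullet> y"
  by (metis dot_lmul_matrix inner_commute transpose_matrix_vector)

definition orth_proj :: "real^'n \<Rightarrow> real^'n^'n" where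
  "orth_proj u = mat 1 - (1 / (u \<bullet> u)) *\<^sub>R outer u u"

lemma orth_proj_mult_vector: "orth_proj u *v x = x - ((u \<bullet> x) / (u \<bullet> u)) *\<^sub>R u"
  by (simp add: orth_proj_def matrix_vector_mult_diff_rdistrib outer_mult_vector
      flip: scaleR_matrix_vector_assoc)

lemma transpose_orth_proj: "transpose (orth_proj u) = orth_proj u"
  by (simp add: orth_proj_def transpose_diff transpose_scaleR transpose_outer)

lemma norm_orth_proj_mult_vector:
  assumes "u \<noteq> 0"
  shows "norm (orth_proj u *v x) \<le> norm x"
proof -
  have "(norm (orth_proj u *v x))\<^sup>2 = (norm x)\<^sup>2 - (u \<bullet> x)\<^sup>2 / (u \<bullet> u)"
    using assms unfolding orth_proj_mult_vector power2_norm_eq_inner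
    by (simp add: inner_diff_left inner_diff_right inner_commute power2_eq_square field_simps)
  then have "(norm (orth_proj u *v x))\<^sup>2 \<le> (norm x)\<^sup>2"
    by simp
  then show ?thesis by (rule power2_le_imp_le) simp
qed

text \<open>Multiplication from the right projects every row off \<open>u\<close>. By Pythagoras
  each row loses the square of its component along \<open>u\<close>, and these losses add up to the
  square of \<open>norm (A *v u) / norm u\<close>.\<close>

lemma norm_mult_orth_proj:
  fixes A :: "real^'n^'m"
  assumes "u \<noteq> 0"
  shows "(norm (A ** orth_proj u))\<^sup>2 = (norm A)\<^sup>2 - (norm (A *v u) / norm u)\<^sup>2"
proof -
  have row: "(A ** orth_proj u) $ i = A $ i - ((A $ i \<bullet> u) / (u \<bullet> u)) *\<^sub>R u" for i
  proof -
    have "(A ** orth_proj u) $ i = transpose (orth_proj u) *v (A $ i)"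
      by (simp add: vec_eq_iff matrix_matrix_mult_def matrix_vector_mult_def transpose_def mult.commute)
    then show ?thesis
      by (simp only: transpose_orth_proj orth_proj_mult_vector inner_commute)
  qed
  have "(norm ((A ** orth_proj u) $ i))\<^sup>2 = (norm (A $ i))\<^sup>2 - (A $ i \<bullet> u)\<^sup>2 / (u \<bullet> u)" for i
    using assms unfolding row power2_norm_eq_inner
    by (simp add: inner_diff_left inner_diff_right inner_commute power2_eq_square field_simps)
  then have "(norm (A ** orth_proj u))\<^sup>2 = (norm A)\<^sup>2 - (\<Sum>i\<in>UNIV. (A $ i \<bullet> u)\<^sup>2) / (u \<bullet> u)"
    by (simp add: power2_norm_matrix sum_subtractf sum_divide_distrib)
  also have "(\<Sum>i\<in>UNIV. (A $ i \<bullet> u)\<^sup>2) = (norm (A *v u))\<^sup>2"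
    by (simp add: power2_norm_matrix_vector_mult)
  finally show ?thesis
    by (simp add: power_divide power2_norm_eq_inner)
qed

text \<open>Transposition turns the left factor into a right factor, which cannot increase the norm.
  The whole gain is taken from the right factor; it is the quantity that
  \<open>bounded_deterioration\<close> sums.\<close>

lemma norm_orth_proj_sandwich:
  fixes A :: "real^'n^'n"
  assumes "u \<noteq> 0"
  shows "(norm (orth_proj u ** A ** orth_proj u))\<^sup>2 \<le> (norm A)\<^sup>2 - (norm (A *v u) / norm u)\<^sup>2"
proof -
  let ?B = "A ** orth_proj u"
  have "orth_proj u ** A ** orth_proj u = transpose (transpose ?B ** orth_proj u)"
    by (simp add: matrix_transpose_mul transpose_orth_proj matrix_mul_assoc)
  then have "(norm (orth_proj u ** A ** orth_proj u))\<^sup>2 = (norm (transpose ?B ** orth_proj u))\<^sup>2"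
    by (simp add: norm_transpose)
  also have "\<dots> \<le> (norm ?B)\<^sup>2"
    using norm_mult_orth_proj[OF assms, of "transpose ?B"] by (simp add: norm_transpose)
  finally show ?thesis
    using norm_mult_orth_proj[OF assms, of A] by simp
qed

subsection \<open>Steps along which the inverse matrices deteriorate boundedly\<close>

text \<open>The projections do not increase the norm, so \<open>1 + norm (E k)\<close> grows at most
  by the factor \<open>1 + \<sigma> k\<close>, and the products of these factors stay bounded. Once
  \<open>E\<close> is bounded, its squared norm drops by the square of \<open>a k\<close> up to a
  summable error, and telescoping bounds the sum of all drops.\<close>

lemma bounded_deterioration:
  fixes E :: "nat \<Rightarrow> real^'n^'n" and u :: "nat \<Rightarrow> real^'n" and \<sigma> :: "nat \<Rightarrow> real"
  assumes u: "\<And>k. u k \<noteq> 0" and \<sigma>: "\<And>k. 0 \<le> \<sigma> k" "summable \<sigma>"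
    and upd: "\<And>k. norm (E (Suc k) - orth_proj (u k) ** E k ** orth_proj (u k)) \<le> \<sigma> k * (1 + norm (E k))"
  shows "\<exists>M. \<forall>k. norm (E k) \<le> M" and "summable (\<lambda>k. (norm (E k *v u k) / norm (u k))\<^sup>2)"
proof -
  define p where "p k = norm (orth_proj (u k) ** E k ** orth_proj (u k))" for k
  define a where "a k = norm (E k *v u k) / norm (u k)" for k
  have p2: "(p k)\<^sup>2 \<le> (norm (E k))\<^sup>2 - (a k)\<^sup>2" for k
    using norm_orth_proj_sandwich[OF u] by (simp add: p_def a_def)
  have ple: "p k \<le> norm (E k)" for k
    by (rule power2_le_imp_le) (use p2[of k] zero_le_power2[of "a k"] in \<open>linarith, simp\<close>)
  have step: "norm (E (Suc k)) \<le> p k + \<sigma> k * (1 + norm (E k))" for k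
    using upd[of k] norm_triangle_sub[of "E (Suc k)" "orth_proj (u k) ** E k ** orth_proj (u k)"]
    unfolding p_def by linarith
  have grow: "1 + norm (E k) \<le> (1 + norm (E 0)) * exp (\<Sum>j<k. \<sigma> j)" for k
  proof (induction k)
    case (Suc k)
    have "1 + norm (E (Suc k)) \<le> (1 + norm (E k)) * (1 + \<sigma> k)"
      using step[of k] ple[of k] by (simp add: algebra_simps)
    also have "\<dots> \<le> ((1 + norm (E 0)) * exp (\<Sum>j<k. \<sigma> j)) * exp (\<sigma> k)"
      using Suc.IH \<sigma>(1)[of k] by (intro mult_mono) (auto simp: exp_ge_add_one_self)
    finally show ?case
      by (simp add: exp_add mult.assoc)
  qed simp
  define M where "M = (1 + norm (E 0)) * exp (suminf \<sigma>)"
  have M: "1 + norm (E k) \<le> M" for k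
  proof -
    have "(\<Sum>j<k. \<sigma> j) \<le> suminf \<sigma>"
      using \<sigma> by (intro sum_le_suminf) auto
    then have "(1 + norm (E 0)) * exp (\<Sum>j<k. \<sigma> j) \<le> M"
      unfolding M_def by (intro mult_left_mono) auto
    then show ?thesis using grow[of k] by linarith
  qed
  show "\<exists>M. \<forall>k. norm (E k) \<le> M"
  proof (intro exI[of _ M] allI)
    show "norm (E k) \<le> M" for k using M[of k] by linarith
  qed
  have M1: "1 \<le> M" using M[of 0] norm_ge_zero[of "E 0"] by linarith
  define S where "S = suminf \<sigma>"
  have sle: "\<sigma> k \<le> S" for k
    using sum_le_suminf[OF \<sigma>(2), of "{k}"] \<sigma>(1) by (simp add: S_def)
  have S0: "0 \<le> S" using sle[of 0] \<sigma>(1)[of 0] by linarith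
  \<comment> \<open>When \<open>p k + \<sigma> k * M\<close> is squared, one factor
    \<open>\<sigma> k\<close> is kept and the other is bounded by \<open>S\<close>. Together with
    \<open>p k \<le> M\<close> this gives the constant.\<close>
  have a2: "(a k)\<^sup>2 \<le> (norm (E k))\<^sup>2 - (norm (E (Suc k)))\<^sup>2 + \<sigma> k * (M\<^sup>2 * (2 + S))" for k
  proof -
    have b: "norm (E (Suc k)) \<le> p k + \<sigma> k * M"
      using step[of k] mult_left_mono[OF M[of k] \<sigma>(1)[of k]] by linarith
    have pM: "p k \<le> M" using ple[of k] M[of k] by linarith
    have "(norm (E (Suc k)))\<^sup>2 \<le> (p k + \<sigma> k * M)\<^sup>2"
      using b by (intro power_mono) auto
    also have "\<dots> = (p k)\<^sup>2 + \<sigma> k * (2 * M * p k + \<sigma> k * M\<^sup>2)"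
      by (simp add: power2_eq_square algebra_simps)
    also have "\<dots> \<le> (p k)\<^sup>2 + \<sigma> k * (2 * M * M + S * M\<^sup>2)"
      using pM sle[of k] \<sigma>(1)[of k] M1
      by (intro add_left_mono mult_left_mono add_mono mult_right_mono) auto
    finally show ?thesis
      using p2[of k] by (simp add: power2_eq_square algebra_simps)
  qed
  have "(\<Sum>k<n. (a k)\<^sup>2) \<le> (norm (E 0))\<^sup>2 + S * (M\<^sup>2 * (2 + S))" for n
  proof -
    have "(\<Sum>k<n. (a k)\<^sup>2) \<le> (\<Sum>k<n. (norm (E k))\<^sup>2 - (norm (E (Suc k)))\<^sup>2 + \<sigma> k * (M\<^sup>2 * (2 + S)))"
      by (intro sum_mono a2)
    also have "\<dots> = (norm (E 0))\<^sup>2 - (norm (E n))\<^sup>2 + (\<Sum>k<n. \<sigma> k) * (M\<^sup>2 * (2 + S))"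
      using sum_lessThan_telescope'[of "\<lambda>k. (norm (E k))\<^sup>2" n]
      by (simp add: sum.distrib flip: sum_distrib_right)
    also have "(\<Sum>k<n. \<sigma> k) * (M\<^sup>2 * (2 + S)) \<le> S * (M\<^sup>2 * (2 + S))"
      using \<sigma> S0 unfolding S_def by (intro mult_right_mono sum_le_suminf) auto
    finally show ?thesis by (smt (verit) zero_le_power2)
  qed
  then show "summable (\<lambda>k. (norm (E k *v u k) / norm (u k))\<^sup>2)"
    unfolding a_def by (intro summableI_nonneg_bounded) auto
qed

text \<open>A step that is not superlinear leaves \<open>g\<close> almost in the kernel of \<open>mat 1 + E\<close>, while every
  late displacement is almost in the kernel of \<open>E\<close>; eigenvectors of a symmetric matrix for the
  eigenvalues \<open>-1\<close> and \<open>0\<close> are orthogonal.\<close>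

lemma almost_orthogonal_to_next_step:
  fixes E E' :: "real^'n^'n" and u u' g :: "real^'n"
  assumes u: "u \<noteq> 0" "u' \<noteq> 0" and sym: "transpose E = E" "transpose E' = E'"
    and M: "norm E \<le> M" and s: "0 \<le> s" and c: "0 \<le> c"
    and upd: "norm (E' - orth_proj u ** E ** orth_proj u) \<le> s"
    and eq: "norm (g + E *v g - E *v u) \<le> s * (norm u + norm g)"
    and bad: "norm u \<le> c * norm g"
  shows "\<bar>u' \<bullet> g\<bar> \<le> ((2 * c + 4 + M * (c + 2)) * (norm (E *v u) / norm u + s)
            + norm (E' *v u') / norm u') * (norm u' * norm g)"
proof -
  define a where "a = norm (E *v u) / norm u"
  \<comment> \<open>The hypothesis \<open>bad\<close> exchanges multiples of \<open>norm u\<close>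
    for \<open>c\<close> times the same multiples of \<open>norm g\<close>; this produces the factor
    \<open>c + 1\<close>.\<close>
  define \<tau> where "\<tau> = (c + 1) * (a + s)"
  have a: "norm (E *v u) = a * norm u" "0 \<le> a" using u by (auto simp: a_def)
  have \<tau>0: "0 \<le> \<tau>" using a s c by (simp add: \<tau>_def)
  have Kg: "norm (g + E *v g) \<le> \<tau> * norm g"
  proof -
    have "norm (g + E *v g) \<le> norm (E *v u) + s * (norm u + norm g)"
      using eq norm_triangle_sub[of "g + E *v g" "E *v u"] by linarith
    also have "\<dots> = (a + s) * norm u + s * norm g" using a by (simp add: algebra_simps)
    also have "\<dots> \<le> (a + s) * (c * norm g) + (a + s) * norm g"
      using bad a s by (intro add_mono mult_left_mono mult_right_mono) auto
    finally show ?thesis by (simp add: \<tau>_def algebra_simps)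
  qed
  \<comment> \<open>Symmetry moves \<open>E\<close> from \<open>g\<close> to \<open>u\<close>. Both
    parts of \<open>u \<bullet> g\<close> are then small, since \<open>g\<close> is almost in the
    kernel of \<open>mat 1 + E\<close> and \<open>u\<close> almost in the kernel of
    \<open>E\<close>.\<close>
  have ug: "\<bar>u \<bullet> g\<bar> \<le> (\<tau> + a) * norm u * norm g"
  proof -
    have "u \<bullet> g = u \<bullet> (g + E *v g) - (E *v u) \<bullet> g"
      using symmetric_matrix_inner[OF sym(1)] by (simp add: inner_add_right)
    then have "\<bar>u \<bullet> g\<bar> \<le> \<bar>u \<bullet> (g + E *v g)\<bar> + \<bar>(E *v u) \<bullet> g\<bar>" by linarith
    also have "\<dots> \<le> norm u * norm (g + E *v g) + norm (E *v u) * norm g"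
      by (intro add_mono Cauchy_Schwarz_ineq2)
    also have "\<dots> \<le> norm u * (\<tau> * norm g) + (a * norm u) * norm g"
      using Kg a by (intro add_mono mult_left_mono) auto
    finally show ?thesis by (simp add: algebra_simps)
  qed
  \<comment> \<open>The part of \<open>g\<close> that the projection removes is small compared with
    \<open>g\<close>.\<close>
  define \<beta> where "\<beta> = (u \<bullet> g) / (u \<bullet> u)"
  have \<beta>: "norm (\<beta> *\<^sub>R u) \<le> (\<tau> + a) * norm g"
  proof -
    have "norm (\<beta> *\<^sub>R u) * norm u = \<bar>u \<bullet> g\<bar>"
      using u by (simp add: \<beta>_def dot_square_norm power2_eq_square)
    then have "norm (\<beta> *\<^sub>R u) * norm u \<le> ((\<tau> + a) * norm g) * norm u"
      using ug by (simp add: mult_ac)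
    then show ?thesis using u by simp
  qed
  define R where "R = E' - orth_proj u ** E ** orth_proj u"
  have Pg: "orth_proj u *v g = g - \<beta> *\<^sub>R u"
    by (simp add: orth_proj_mult_vector \<beta>_def)
  \<comment> \<open>The projection almost fixes \<open>g\<close>, so \<open>g\<close> stays almost
    in the kernel of \<open>mat 1 + E'\<close> after the update; \<open>R\<close> is the error of
    the update.\<close>
  have "E' *v g = orth_proj u *v (E *v (orth_proj u *v g)) + R *v g"
    by (simp add: R_def matrix_vector_mult_diff_rdistrib matrix_vector_mul_assoc matrix_mul_assoc)
  also have "\<dots> = orth_proj u *v ((g + E *v g) - g - E *v (\<beta> *\<^sub>R u)) + R *v g"
    by (simp add: Pg matrix_vector_mult_diff_distrib)
  also have "\<dots> = orth_proj u *v (g + E *v g) - (g - \<beta> *\<^sub>R u) - orth_proj u *v (E *v (\<beta> *\<^sub>R u)) + R *v g"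
    by (simp only: matrix_vector_mult_diff_distrib Pg)
  finally have K'g: "g + E' *v g = \<beta> *\<^sub>R u + orth_proj u *v (g + E *v g) - orth_proj u *v (E *v (\<beta> *\<^sub>R u)) + R *v g"
    by simp
  \<comment> \<open>After \<open>a\<close> and \<open>s\<close> are enlarged to
    \<open>a + s\<close>, the coefficients of the four error terms add up to
    \<open>(M + 2) * (c + 2)\<close> times \<open>a + s\<close>, which is \<open>C\<close>
    expanded.\<close>
  define C where "C = 2 * c + 4 + M * (c + 2)"
  have M0: "0 \<le> M" using norm_ge_zero M by (rule order_trans)
  have K'gle: "norm (g + E' *v g) \<le> C * (a + s) * norm g"
  proof -
    have "norm (g + E' *v g) \<le> norm (\<beta> *\<^sub>R u) + norm (orth_proj u *v (g + E *v g))
        + norm (orth_proj u *v (E *v (\<beta> *\<^sub>R u))) + norm (R *v g)"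
      unfolding K'g by (intro norm_triangle_le norm_triangle_le_diff add_mono order_refl)
    also have "\<dots> \<le> (\<tau> + a) * norm g + \<tau> * norm g + M * ((\<tau> + a) * norm g) + s * norm g"
    proof (intro add_mono \<beta>)
      show "norm (orth_proj u *v (g + E *v g)) \<le> \<tau> * norm g"
        using norm_orth_proj_mult_vector[OF u(1)] Kg by (rule order_trans)
      have "norm (orth_proj u *v (E *v (\<beta> *\<^sub>R u))) \<le> norm (E *v (\<beta> *\<^sub>R u))"
        by (rule norm_orth_proj_mult_vector[OF u(1)])
      also have "\<dots> \<le> norm E * norm (\<beta> *\<^sub>R u)" by (rule norm_matrix_vector_mult_le)
      also have "\<dots> \<le> M * ((\<tau> + a) * norm g)" using M M0 \<beta> by (intro mult_mono) auto
      finally show "norm (orth_proj u *v (E *v (\<beta> *\<^sub>R u))) \<le> M * ((\<tau> + a) * norm g)" .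
      show "norm (R *v g) \<le> s * norm g"
        using norm_matrix_vector_mult_le[of R g] upd mult_right_mono[of "norm R" s "norm g"]
        by (simp add: R_def)
    qed
    also have "\<dots> = ((1 + M) * (\<tau> + a) + \<tau> + s) * norm g" by (simp add: algebra_simps)
    also have "\<dots> \<le> ((1 + M) * (\<tau> + (a + s)) + \<tau> + (a + s)) * norm g"
      using M0 a s by (intro mult_right_mono add_mono mult_left_mono) auto
    also have "\<dots> = C * (a + s) * norm g"
      by (simp add: C_def \<tau>_def algebra_simps)
    finally show ?thesis .
  qed
  \<comment> \<open>The splitting used for \<open>u \<bullet> g\<close> is repeated with
    \<open>E'\<close> and the next step.\<close>
  have "u' \<bullet> g = u' \<bullet> (g + E' *v g) - (E' *v u') \<bullet> g"
    using symmetric_matrix_inner[OF sym(2)] by (simp add: inner_add_right)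
  then have "\<bar>u' \<bullet> g\<bar> \<le> \<bar>u' \<bullet> (g + E' *v g)\<bar> + \<bar>(E' *v u') \<bullet> g\<bar>" by linarith
  also have "\<dots> \<le> norm u' * norm (g + E' *v g) + norm (E' *v u') * norm g"
    by (intro add_mono Cauchy_Schwarz_ineq2)
  also have "\<dots> \<le> norm u' * (C * (a + s) * norm g) + norm (E' *v u') * norm g"
    using K'gle by (intro add_mono mult_left_mono) auto
  also have "\<dots> = (C * (a + s) + norm (E' *v u') / norm u') * (norm u' * norm g)"
    using u by (simp add: field_simps)
  finally show ?thesis by (simp add: C_def a_def)
qed

section \<open>Coercive quadratic forms and decay of the gradient along quasi-Newton steps\<close>

lemma pos_def_coercive:
  assumes "pos_def (A :: real^'n^'n)"
  obtains m where "0 < m" "\<And>x. m * (norm x)\<^sup>2 \<le> x \<bullet> (A *v x)"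
proof -
  \<comment> \<open>Compactness of the unit sphere provides a positive minimum, and homogeneity of
    degree two carries the bound to all vectors.\<close>
  let ?f = "\<lambda>x. x \<bullet> (A *v x)"
  have "continuous_on (sphere 0 1) ?f"
    by (intro continuous_intros linear_continuous_on matrix_vector_mul_bounded_linear)
  moreover have "axis undefined 1 \<in> sphere (0::real^'n) 1" by simp
  ultimately obtain z where z: "z \<in> sphere 0 1" "\<And>x. x \<in> sphere 0 1 \<Longrightarrow> ?f z \<le> ?f x"
    using continuous_attains_inf[OF compact_sphere, of 0 1 ?f] by blast
  show ?thesis
  proof (rule that)
    have "z \<noteq> 0" using z(1) by auto
    then show "0 < ?f z" using assms unfolding pos_def_def by blast
    show "?f z * (norm x)\<^sup>2 \<le> ?f x" for x
    proof (cases "x = 0")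
      case False
      have "?f z \<le> ?f ((1 / norm x) *\<^sub>R x)" using False by (intro z(2)) simp
      also have "\<dots> = ?f x / (norm x)\<^sup>2"
        by (simp add: matrix_vector_mult_scaleR power2_eq_square)
      finally show ?thesis using False by (simp add: field_simps)
    qed simp
  qed
qed

lemma coercive_norm_le:
  fixes A :: "real^'n^'n"
  assumes "m * (norm x)\<^sup>2 \<le> x \<bullet> (A *v x)"
  shows "m * norm x \<le> norm (A *v x)"
proof (cases "x = 0")
  case False
  have "m * norm x * norm x \<le> norm (A *v x) * norm x"
    using assms norm_cauchy_schwarz[of x "A *v x"] by (simp add: power2_eq_square mult_ac)
  then show ?thesis using False by simp
qed simp

text \<open>The argument is by contradiction. \<open>energy\<close> shows that a late step violating
  the estimate is followed by another one and that the energy \<open>W\<close> is almost preserved.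
  Induction keeps \<open>W\<close> above half of its value at the first violation, although
  \<open>lim\<close> forces it to tend to zero.\<close>

lemma quasi_newton_gradient_decay:
  fixes e u :: "nat \<Rightarrow> real^'n" and E :: "nat \<Rightarrow> real^'n^'n" and \<sigma> :: "nat \<Rightarrow> real"
  assumes G: "transpose G = G" "pos_def G"
    and lim: "e \<longlonglongrightarrow> 0" and u_def: "\<And>k. u k = e (Suc k) - e k" and u0: "\<And>k. u k \<noteq> 0"
    and symE: "\<And>k. transpose (E k) = E k"
    and \<sigma>: "\<And>k. 0 \<le> \<sigma> k" "summable \<sigma>"
    and upd: "\<And>k. norm (E (Suc k) - orth_proj (u k) ** E k ** orth_proj (u k)) \<le> \<sigma> k * (1 + norm (E k))"
    and eq: "\<And>k. norm (G *v e (Suc k) + E k *v (G *v e (Suc k)) - E k *v u k)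
              \<le> \<sigma> k * (1 + norm (E k)) * (norm (u k) + norm (G *v e (Suc k)))"
    and \<delta>: "0 < \<delta>"
  shows "\<exists>K. \<forall>k\<ge>K. norm (G *v e (Suc k)) \<le> \<delta> * norm (u k)"
proof -
  obtain M where M: "\<And>k. norm (E k) \<le> M"
    using bounded_deterioration(1)[OF u0 \<sigma> upd] by blast
  have M0: "0 \<le> M" using norm_ge_zero M by (rule order_trans)
  define a where "a k = norm (E k *v u k) / norm (u k)" for k
  have sa: "summable (\<lambda>k. (a k)\<^sup>2)"
    using bounded_deterioration(2)[OF u0 \<sigma> upd] by (simp add: a_def)
  define s where "s k = \<sigma> k * (1 + M)" for k
  have s0: "0 \<le> s k" for k using \<sigma> M0 by (simp add: s_def)
  have sums: "summable s" unfolding s_def using \<sigma>(2) by (rule summable_mult2)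
  \<comment> \<open>Each term is at most the whole sum, so summability passes to the squares.
    Squares are needed because the energy loss \<open>t\<close> is quadratic in
    \<open>\<epsilon>\<close>.\<close>
  have ss: "summable (\<lambda>k. (s k)\<^sup>2)"
  proof (rule summable_comparison_test')
    show "summable (\<lambda>k. suminf s * s k)" using sums by (rule summable_mult)
    show "norm ((s k)\<^sup>2) \<le> suminf s * s k" for k
      using sum_le_suminf[OF sums, of "{k}"] s0 by (simp add: power2_eq_square mult_right_mono)
  qed
  have sle: "\<sigma> k * (1 + norm (E k)) \<le> s k" for k
    unfolding s_def using M \<sigma> by (intro mult_left_mono) auto
  have upd': "norm (E (Suc k) - orth_proj (u k) ** E k ** orth_proj (u k)) \<le> s k" for k
    using upd sle by (rule order_trans)
  have eq': "norm (G *v e (Suc k) + E k *v (G *v e (Suc k)) - E k *v u k)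
              \<le> s k * (norm (u k) + norm (G *v e (Suc k)))" for k
    using eq by (rule order_trans) (intro mult_right_mono sle, simp)
  obtain m where m: "0 < m" "\<And>x. m * (norm x)\<^sup>2 \<le> x \<bullet> (G *v x)"
    using pos_def_coercive[OF G(2)] by blast
  \<comment> \<open>\<open>W\<close> is the energy of an error. \<open>W_le\<close> and
    \<open>g_le\<close> make it comparable with the square of \<open>norm (G *v x)\<close>.\<close>
  define W where "W x = x \<bullet> (G *v x)" for x :: "real^'n"
  have W0: "0 \<le> W x" for x
    unfolding W_def using m(1) by (intro order_trans[OF _ m(2)]) simp
  have g_ge: "m * norm x \<le> norm (G *v x)" for x
    using m(2) by (rule coercive_norm_le)
  have W_le: "m * W x \<le> (norm (G *v x))\<^sup>2" for x
  proof -
    have "m * W x \<le> m * (norm x * norm (G *v x))"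
      unfolding W_def using m(1) norm_cauchy_schwarz by (intro mult_left_mono) auto
    also have "\<dots> = (m * norm x) * norm (G *v x)" by simp
    also have "\<dots> \<le> norm (G *v x) * norm (G *v x)" using g_ge by (intro mult_right_mono) auto
    finally show ?thesis by (simp add: power2_eq_square)
  qed
  have g_le: "m * (norm (G *v x))\<^sup>2 \<le> (norm G)\<^sup>2 * W x" for x
  proof -
    have "m * (norm (G *v x))\<^sup>2 \<le> m * (norm G * norm x)\<^sup>2"
      using m(1) norm_matrix_vector_mult_le by (intro mult_left_mono power_mono) auto
    also have "\<dots> = (norm G)\<^sup>2 * (m * (norm x)\<^sup>2)" by (simp add: power_mult_distrib)
    also have "\<dots> \<le> (norm G)\<^sup>2 * W x" unfolding W_def using m(2) by (intro mult_left_mono) auto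
    finally show ?thesis .
  qed
  \<comment> \<open>The cap \<open>m / 2\<close> lets a violation reproduce itself: an energy of at
    least \<open>m / 2\<close> times the squared length of the next step forces the next
    \<open>norm (G *v e _)\<close> to be at least \<open>m / 2\<close> times that length.\<close>
  define \<delta>' where "\<delta>' = min \<delta> (m / 2)"
  have \<delta>': "0 < \<delta>'" "\<delta>' \<le> \<delta>" "\<delta>' \<le> m / 2" using \<delta> m(1) by (auto simp: \<delta>'_def)
  define c where "c = 1 / \<delta>'"
  define C where "C = 2 * c + 4 + M * (c + 2)"
  define \<epsilon> where "\<epsilon> k = C * (a k + s k) + a (Suc k)" for k
  \<comment> \<open>The relative energy loss that remains when Young's inequality has split the
    cross term and \<open>g_le\<close> has turned the gradient back into energy.\<close>
  define t where "t k = 2 * (norm G)\<^sup>2 / m\<^sup>2 * (\<epsilon> k)\<^sup>2" for k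
  have t0: "0 \<le> t k" for k by (simp add: t_def)
  have "summable (\<lambda>k. (\<epsilon> k)\<^sup>2)"
  proof (rule summable_comparison_test')
    show "summable (\<lambda>k. 3 * (C\<^sup>2 * (a k)\<^sup>2 + C\<^sup>2 * (s k)\<^sup>2 + (a (Suc k))\<^sup>2))"
      using sa ss by (intro summable_mult summable_add) (simp_all add: summable_Suc_iff[of "\<lambda>k. (a k)\<^sup>2"])
    have "(x + y + z)\<^sup>2 \<le> 3 * (x\<^sup>2 + y\<^sup>2 + z\<^sup>2)" for x y z :: real
      using zero_le_power2[of "x - y"] zero_le_power2[of "x - z"] zero_le_power2[of "y - z"]
      by (simp add: power2_eq_square algebra_simps)
    from this[of "C * a _" "C * s _" "a (Suc _)"]
    show "norm ((\<epsilon> k)\<^sup>2) \<le> 3 * (C\<^sup>2 * (a k)\<^sup>2 + C\<^sup>2 * (s k)\<^sup>2 + (a (Suc k))\<^sup>2)" for k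
      by (simp add: \<epsilon>_def algebra_simps power_mult_distrib)
  qed
  then have "summable t" unfolding t_def by (rule summable_mult)
  \<comment> \<open>Tails of \<open>t\<close> below one half serve twice: each factor
    \<open>1 - t k\<close> is positive, and the accumulated loss is at most half of the
    energy.\<close>
  then obtain K where K0: "\<And>i j. i \<ge> K \<Longrightarrow> norm (sum t {i..<j}) < 1/2"
    unfolding summable_Cauchy by (meson half_gt_zero zero_less_one)
  then have K: "sum t {i..<j} < 1/2" if "i \<ge> K" for i j
    using K0[OF that, of j] by auto
  have tK: "t k < 1/2" if "k \<ge> K" for k
    using K[OF that, of "Suc k"] by simp
  have eS: "e (Suc k) = e k + u k" for k by (simp add: u_def)
  have energy: "(1 - t k) * W (e (Suc k)) + m / 2 * (norm (u (Suc k)))\<^sup>2 \<le> W (e (Suc (Suc k)))"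
    if bad: "\<delta>' * norm (u k) \<le> norm (G *v e (Suc k))" for k
  proof -
    define g where "g = G *v e (Suc k)"
    define v where "v = u (Suc k)"
    have "norm (u k) \<le> c * norm g" using bad \<delta>' by (simp add: c_def g_def field_simps)
    then have orth: "\<bar>v \<bullet> g\<bar> \<le> \<epsilon> k * (norm v * norm g)"
      using almost_orthogonal_to_next_step[OF u0[of k] u0[of "Suc k"] symE symE M[of k] s0[of k],
            where c = c and g = g]
        upd'[of k] eq'[of k] \<delta>'
      by (simp add: g_def v_def \<epsilon>_def C_def a_def c_def)
    \<comment> \<open>The quadratic form is expanded at the present error. The cross term
      \<open>2 * (v \<bullet> g)\<close> is almost zero by \<open>orth\<close>, so the energy of the
      step is gained almost completely.\<close>
    have "W (e (Suc (Suc k))) = W (e (Suc k)) + 2 * (v \<bullet> g) + W v"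
      using symmetric_matrix_inner[OF G(1), of "e (Suc k)" v]
      unfolding eS[of "Suc k"] W_def g_def v_def
      by (simp add: matrix_vector_right_distrib inner_add_left inner_add_right inner_commute)
    moreover have "m * (norm v)\<^sup>2 \<le> W v" using m(2) by (simp add: W_def)
    moreover have "2 * \<bar>v \<bullet> g\<bar> \<le> m / 2 * (norm v)\<^sup>2 + t k * W (e (Suc k))"
    proof -
      define x where "x = norm v"
      define y where "y = \<epsilon> k * norm g"
      \<comment> \<open>The weights in Young's inequality are chosen so that the cross term uses up
        only half of the coercivity bound for \<open>W v\<close>; the other half is what
        \<open>energy\<close> retains.\<close>
      have "0 \<le> (m * x - 2 * y)\<^sup>2" by simp
      then have "2 * (x * y) \<le> m / 2 * x\<^sup>2 + 2 / m * y\<^sup>2"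
        using m(1) by (simp add: power2_eq_square field_simps)
      moreover have "2 / m * y\<^sup>2 = 2 / m\<^sup>2 * (\<epsilon> k)\<^sup>2 * (m * (norm g)\<^sup>2)"
        using m(1) by (simp add: y_def power2_eq_square)
      moreover have "\<dots> \<le> 2 / m\<^sup>2 * (\<epsilon> k)\<^sup>2 * ((norm G)\<^sup>2 * W (e (Suc k)))"
        unfolding g_def using g_le by (intro mult_left_mono) auto
      ultimately have "2 * (x * y) \<le> m / 2 * x\<^sup>2 + t k * W (e (Suc k))"
        by (simp add: t_def mult_ac)
      then show ?thesis using orth by (simp add: x_def y_def mult_ac)
    qed
    ultimately show ?thesis by (simp add: v_def algebra_simps)
  qed
  have "norm (G *v e (Suc k)) \<le> \<delta>' * norm (u k)" if kK: "k \<ge> K" for k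
  proof (rule ccontr)
    assume "\<not> ?thesis"
    then have bad0: "\<delta>' * norm (u k) \<le> norm (G *v e (Suc k))" "norm (G *v e (Suc k)) \<noteq> 0"
      using \<delta>' u0[of k] by (auto simp: mult_less_0_iff not_le)
    define w where "w = W (e (Suc k))"
    have "0 < w"
    proof -
      have "e (Suc k) \<noteq> 0" using bad0(2) by auto
      then show ?thesis using G(2) by (simp add: w_def W_def pos_def_def)
    qed
    \<comment> \<open>The two claims have to be carried together: the violation at one index is what
      allows \<open>energy\<close> to be applied there, and \<open>energy\<close> yields both claims
      at the next index.\<close>
    have *: "\<delta>' * norm (u (k + j)) \<le> norm (G *v e (Suc (k + j))) \<and>
        w * (1 - sum t {k..<k+j}) \<le> W (e (Suc (k + j)))" for j
    proof (induction j)
      case 0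
      then show ?case using bad0 by (simp add: w_def)
    next
      case (Suc j)
      let ?i = "k + j"
      have ti: "t ?i < 1/2" using tK kK by simp
      note en = energy[OF conjunct1[OF Suc.IH]]
      have "0 \<le> (1 - t ?i) * W (e (Suc ?i))"
        using ti W0 by (intro mult_nonneg_nonneg) auto
      then have "m / 2 * (norm (u (Suc ?i)))\<^sup>2 \<le> W (e (Suc (Suc ?i)))"
        using en by linarith
      then have "m * (m / 2 * (norm (u (Suc ?i)))\<^sup>2) \<le> (norm (G *v e (Suc (Suc ?i))))\<^sup>2"
        using m(1) by (intro order_trans[OF mult_left_mono W_le]) auto
      moreover have "(m / 2 * norm (u (Suc ?i)))\<^sup>2 \<le> m * (m / 2 * (norm (u (Suc ?i)))\<^sup>2)"
        using m(1) by (simp add: power2_eq_square mult_ac)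
      ultimately have "(m / 2 * norm (u (Suc ?i)))\<^sup>2 \<le> (norm (G *v e (Suc (Suc ?i))))\<^sup>2"
        by linarith
      then have "m / 2 * norm (u (Suc ?i)) \<le> norm (G *v e (Suc (Suc ?i)))"
        by (rule power2_le_imp_le) simp
      then have 1: "\<delta>' * norm (u (Suc ?i)) \<le> norm (G *v e (Suc (Suc ?i)))"
        using mult_right_mono[OF \<delta>'(3), of "norm (u (Suc ?i))"] by simp
      \<comment> \<open>The product of the factors \<open>1 - t i\<close> is bounded below by one
        minus their sum, as in the Weierstrass product inequality.\<close>
      have "w * (1 - sum t {k..<Suc ?i}) \<le> (1 - t ?i) * (w * (1 - sum t {k..<?i}))"
        using \<open>0 < w\<close> t0 by (simp add: algebra_simps sum_nonneg)
      also have "\<dots> \<le> (1 - t ?i) * W (e (Suc ?i))"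
        using Suc.IH ti by (intro mult_left_mono) auto
      also have "\<dots> \<le> W (e (Suc (Suc ?i)))"
      proof -
        have "0 \<le> m / 2 * (norm (u (Suc ?i)))\<^sup>2" using m(1) by simp
        then show ?thesis using en by linarith
      qed
      finally show ?case using 1 by simp
    qed
    have "w * (1/2) \<le> W (e (j + Suc k))" for j
    proof -
      have "w * (1/2) \<le> w * (1 - sum t {k..<k+j})"
        using K[OF kK, of "k + j"] \<open>0 < w\<close> by (intro mult_left_mono) auto
      then show ?thesis using *[of j] by (simp add: add.commute)
    qed
    moreover have "(\<lambda>j. W (e (j + Suc k))) \<longlonglongrightarrow> W 0"
      unfolding W_def
      by (intro tendsto_intros LIMSEQ_ignore_initial_segment[OF lim]
          bounded_linear.tendsto[OF matrix_vector_mul_bounded_linear])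
    ultimately have "w * (1/2) \<le> W 0"
      by (intro LIMSEQ_le_const) auto
    then show False using \<open>0 < w\<close> by (simp add: W_def)
  qed
  moreover have "\<delta>' * norm (u k) \<le> \<delta> * norm (u k)" for k
    using \<delta>'(2) by (intro mult_right_mono) auto
  ultimately have "norm (G *v e (Suc k)) \<le> \<delta> * norm (u k)" if "k \<ge> K" for k
    using that order_trans by blast
  then show ?thesis by blast
qed

subsection \<open>BFGS updates\<close>

lemma matrix_add_rdistrib: "(A + B) ** C = A ** C + B ** (C :: real^'k^'n)"
  by (simp add: vec_eq_iff matrix_matrix_mult_def sum.distrib distrib_right)

lemma matrix_diff_ldistrib: "A ** (B - C) = A ** B - A ** (C :: real^'k^'n)"
  and matrix_diff_rdistrib: "(A' - B') ** C = A' ** C - B' ** (C :: real^'k^'n)"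
  by (simp_all add: vec_eq_iff matrix_matrix_mult_def sum_subtractf left_diff_distrib right_diff_distrib)

lemma matrix_inv_inverse:
  assumes "invertible A"
  shows "A ** matrix_inv A = mat 1" "matrix_inv A ** A = mat 1"
  using someI_ex[OF assms[unfolded invertible_def]] by (simp_all add: matrix_inv_def)

definition bfgs_update :: "real^'n^'n \<Rightarrow> real^'n \<Rightarrow> real^'n \<Rightarrow> real^'n^'n" where
  "bfgs_update B u v = B - (1 / (u \<bullet> (B *v u))) *\<^sub>R outer (B *v u) (B *v u)
     + (1 / (u \<bullet> v)) *\<^sub>R outer v v"

text \<open>The product form of the BFGS formula for the inverse matrix, as the
  Sherman-Morrison-Woodbury identity yields it. For \<open>v = u\<close> both outer factors are the
  orthogonal projection off \<open>u\<close>, which is the reason for working with the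
  inverse.\<close>

definition bfgs_inverse_update :: "real^'n^'n \<Rightarrow> real^'n \<Rightarrow> real^'n \<Rightarrow> real^'n^'n" where
  "bfgs_inverse_update K u v = (mat 1 - (1 / (u \<bullet> v)) *\<^sub>R outer u v) ** K
     ** (mat 1 - (1 / (u \<bullet> v)) *\<^sub>R outer v u) + (1 / (u \<bullet> v)) *\<^sub>R outer u u"

lemma transpose_bfgs_update:
  "transpose B = B \<Longrightarrow> transpose (bfgs_update B u v) = bfgs_update B u v"
  by (simp add: bfgs_update_def transpose_add transpose_diff transpose_scaleR transpose_outer)

lemma bfgs_update_mult_vector:
  "bfgs_update B u v *v x = B *v x - (((B *v u) \<bullet> x) / (u \<bullet> (B *v u))) *\<^sub>R (B *v u)
     + ((v \<bullet> x) / (u \<bullet> v)) *\<^sub>R v"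
  by (simp add: bfgs_update_def matrix_vector_mult_add_rdistrib matrix_vector_mult_diff_rdistrib
      outer_mult_vector flip: scaleR_matrix_vector_assoc)

lemma bfgs_inverse_update_mult_vector:
  fixes K :: "real^'n^'n" and u v :: "real^'n"
  defines "s \<equiv> \<lambda>y. y - ((u \<bullet> y) / (u \<bullet> v)) *\<^sub>R v"
  shows "bfgs_inverse_update K u v *v y =
     K *v s y - ((v \<bullet> (K *v s y)) / (u \<bullet> v)) *\<^sub>R u + ((u \<bullet> y) / (u \<bullet> v)) *\<^sub>R u"
  by (simp add: bfgs_inverse_update_def s_def matrix_vector_mult_add_rdistrib
      matrix_vector_mult_diff_rdistrib outer_mult_vector
      flip: scaleR_matrix_vector_assoc matrix_vector_mul_assoc)

text \<open>With \<open>y\<close> the image of \<open>x\<close> under the updated matrix, the secant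
  equation and symmetry give \<open>u \<bullet> y = v \<bullet> x\<close>. The right factor of the
  inverse formula then removes the term in \<open>v\<close>, \<open>K\<close> maps the rest to
  \<open>x - \<alpha> *\<^sub>R u\<close>, and the remaining terms restore the multiple of
  \<open>u\<close>. Only nonzero denominators enter, so the identity survives a loss of
  definiteness.\<close>

lemma bfgs_inverse_update_inverse:
  fixes B K :: "real^'n^'n"
  assumes inv: "K ** B = mat 1" and sym: "transpose B = B"
    and nz: "u \<bullet> (B *v u) \<noteq> 0" "u \<bullet> v \<noteq> 0"
  shows "bfgs_inverse_update K u v ** bfgs_update B u v = mat 1"
proof -
  have KB: "K *v (B *v x) = x" for x
    using inv by (simp add: matrix_vector_mul_assoc)
  have "bfgs_inverse_update K u v *v (bfgs_update B u v *v x) = x" for x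
  proof -
    define y where "y = bfgs_update B u v *v x"
    define \<alpha> where "\<alpha> = (u \<bullet> (B *v x)) / (u \<bullet> (B *v u))"
    have Bux: "(B *v u) \<bullet> x = u \<bullet> (B *v x)" using symmetric_matrix_inner[OF sym] by simp
    have y: "y = B *v x - \<alpha> *\<^sub>R (B *v u) + ((v \<bullet> x) / (u \<bullet> v)) *\<^sub>R v"
      by (simp add: y_def bfgs_update_mult_vector Bux \<alpha>_def)
    have uy: "u \<bullet> y = v \<bullet> x"
      using nz by (simp add: y \<alpha>_def inner_add_right inner_diff_right)
    have Ks: "K *v (y - ((v \<bullet> x) / (u \<bullet> v)) *\<^sub>R v) = x - \<alpha> *\<^sub>R u"
      by (simp add: y matrix_vector_mult_diff_distrib matrix_vector_mult_scaleR KB)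
    have "v \<bullet> (x - \<alpha> *\<^sub>R u) = v \<bullet> x - \<alpha> * (u \<bullet> v)"
      by (simp add: inner_diff_right inner_commute)
    then have "bfgs_inverse_update K u v *v y = x"
      using nz by (simp add: bfgs_inverse_update_mult_vector Ks uy diff_divide_distrib scaleR_diff_left)
    then show ?thesis by (simp add: y_def)
  qed
  then show ?thesis by (simp add: matrix_eq matrix_vector_mul_assoc)
qed

lemma pos_def_invertible:
  assumes "pos_def (A :: real^'n^'n)"
  shows "invertible A"
proof -
  have "x = 0" if "A *v x = 0" for x
    using assms that unfolding pos_def_def by force
  then show ?thesis
    by (simp add: invertible_left_inverse matrix_left_invertible_ker)
qed

text \<open>For \<open>v = u\<close> the deviation from the identity is exactly projected from both
  sides, because the projection is idempotent and complements the last rank-one term. The lemma is a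
  perturbation of this case; \<open>s\<close> is the relative error of \<open>v\<close>.\<close>

lemma bfgs_inverse_update_estimate:
  fixes K :: "real^'n^'n"
  assumes u: "u \<noteq> 0" and v: "norm (v - u) \<le> s * norm u" and s: "0 \<le> s" "s \<le> 1 / 2"
  shows "norm (bfgs_inverse_update K u v - mat 1 - orth_proj u ** (K - mat 1) ** orth_proj u)
    \<le> (4 * (2 * norm (mat 1 :: real^'n^'n) + 5)) * s * (1 + norm (K - mat 1))"
proof -
  define a where "a = norm u"
  have a: "0 < a" "u \<bullet> u = a * a" using u by (auto simp: a_def dot_square_norm power2_eq_square)
  define d where "d = v - u"
  have d: "norm d \<le> s * a" using v by (simp add: d_def a_def)
  define b where "b = u \<bullet> v"
  have bu: "b = a * a + u \<bullet> d" by (simp add: b_def d_def inner_diff_right a)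
  have ud: "\<bar>u \<bullet> d\<bar> \<le> s * (a * a)"
  proof -
    have "\<bar>u \<bullet> d\<bar> \<le> a * norm d" using Cauchy_Schwarz_ineq2[of u d] by (simp add: a_def)
    also have "\<dots> \<le> a * (s * a)" using d a by (intro mult_left_mono) auto
    finally show ?thesis by (simp add: mult_ac)
  qed
  have "s * (a * a) \<le> 1/2 * (a * a)" using s a by (intro mult_right_mono) auto
  \<comment> \<open>The restriction \<open>s \<le> 1 / 2\<close> keeps the curvature
    \<open>b\<close> at least half of \<open>u \<bullet> u\<close>, so that dividing by it costs a
    factor of two at most.\<close>
  then have b: "a * a / 2 \<le> b" using bu ud by linarith
  then have b0: "0 < b" using a by (smt (verit) mult_pos_pos half_gt_zero)
  \<comment> \<open>\<open>outer u w\<close> is the difference between the actual left factor and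
    the projection. Bringing \<open>w\<close> to a common denominator cancels the leading terms and
    leaves only terms linear in \<open>d\<close>.\<close>
  define w where "w = (1 / (u \<bullet> u)) *\<^sub>R u - (1 / b) *\<^sub>R v"
  have w: "norm w * a \<le> 4 * s"
  proof -
    have "w = (1 / (a * a * b)) *\<^sub>R ((u \<bullet> d) *\<^sub>R u - (a * a) *\<^sub>R d)"
    proof -
      have "(a * a * b) *\<^sub>R w = b *\<^sub>R u - (a * a) *\<^sub>R v"
        using a(1) b0 by (simp add: w_def a(2) scaleR_diff_right)
      also have "\<dots> = (u \<bullet> d) *\<^sub>R u - (a * a) *\<^sub>R d"
        by (simp add: bu d_def algebra_simps)
      finally show ?thesis using a(1) b0 by (simp add: eq_vector_fraction_iff)
    qed
    then have "norm w = norm ((u \<bullet> d) *\<^sub>R u - (a * a) *\<^sub>R d) / (a * a * b)"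
      using a(1) b0 by simp
    also have "norm ((u \<bullet> d) *\<^sub>R u - (a * a) *\<^sub>R d) \<le> \<bar>u \<bullet> d\<bar> * a + a * a * norm d"
      using a(1) by (intro norm_triangle_le_diff) (simp add: a_def)
    also have "\<dots> \<le> s * (a * a) * a + a * a * (s * a)"
      using ud d a(1) by (intro add_mono mult_right_mono mult_left_mono) auto
    finally have "norm w \<le> (2 * s * a * (a * a)) / (a * a * b)"
      using a(1) b0 by (simp add: divide_right_mono mult_ac)
    also have "\<dots> = 2 * s * a / b" using a(1) by simp
    also have "\<dots> \<le> 2 * s * a / (a * a / 2)"
      using a(1) b b0 s by (intro divide_left_mono) auto
    finally show ?thesis using a(1) by (simp add: field_simps)
  qed
  define P where "P = orth_proj u"
  define D where "D = outer u w"
  define E where "E = K - mat 1"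
  \<comment> \<open>With \<open>1 / (u \<bullet> u)\<close> in place of \<open>1 / b\<close>, the
    last rank-one term would complete \<open>P\<close> to the identity; \<open>F\<close> is the
    difference.\<close>
  define F where "F = (1 / b - 1 / (u \<bullet> u)) *\<^sub>R outer u u"
  have Q: "mat 1 - (1 / b) *\<^sub>R outer u v = P + D"
    by (simp add: P_def D_def w_def orth_proj_def vec_eq_iff outer_def algebra_simps)
  have Q': "mat 1 - (1 / b) *\<^sub>R outer v u = P + transpose D"
    by (simp add: P_def D_def w_def orth_proj_def vec_eq_iff outer_def transpose_def algebra_simps)
  have K: "K = E + mat 1" by (simp add: E_def)
  have PP: "P ** P = P"
    using a by (simp add: matrix_eq P_def orth_proj_mult_vector inner_diff_right field_simps
        flip: matrix_vector_mul_assoc)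
  have F: "P + (1 / b) *\<^sub>R outer u u - mat 1 = F"
    by (simp add: P_def F_def orth_proj_def algebra_simps)
  have expand: "bfgs_inverse_update K u v - mat 1 - P ** E ** P
     = D ** E ** P + P ** E ** transpose D + D ** E ** transpose D
       + (D ** P + P ** transpose D + D ** transpose D) + F"
    unfolding bfgs_inverse_update_def b_def[symmetric] Q Q' F[symmetric]
    by (simp add: K matrix_add_ldistrib matrix_add_rdistrib PP)
  \<comment> \<open>A crude bound for the Frobenius norm of the projection, which, unlike its
    operator norm, depends on the dimension.\<close>
  define p where "p = norm (mat 1 :: real^'n^'n) + 1"
  have P: "norm P \<le> p"
  proof -
    have "norm P \<le> norm (mat 1 :: real^'n^'n) + norm ((1 / (u \<bullet> u)) *\<^sub>R outer u u)"
      unfolding P_def orth_proj_def by (rule norm_triangle_ineq4)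
    then show ?thesis using a by (simp add: p_def norm_outer a_def)
  qed
  have D: "norm D \<le> 4 * s" using w by (simp add: D_def norm_outer a_def mult.commute)
  then have D2: "norm D \<le> 2" using s by linarith
  have Fle: "norm F \<le> 2 * s"
  proof -
    have "1 / b - 1 / (a * a) = - (u \<bullet> d) / (b * (a * a))"
      using a(1) b0 by (simp add: bu field_simps)
    then have "norm F = \<bar>u \<bullet> d\<bar> / b"
      using a b0 by (simp add: F_def norm_outer flip: a_def)
    also have "\<dots> \<le> (s * (a * a)) / (a * a / 2)"
      using ud b b0 a s by (intro frac_le) auto
    finally show ?thesis using a by simp
  qed
  have mm: "norm (X ** Y) \<le> x * y" if "norm X \<le> x" "norm Y \<le> y" for X Y :: "real^'n^'n" and x y
    using norm_matrix_matrix_mult_le[of X Y] mult_mono[OF that] norm_ge_zero[of X] that(1)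
    by (meson norm_ge_zero order_trans)
  \<comment> \<open>In the terms quadratic in \<open>D\<close> one factor is bounded by 2 and the
    other by \<open>4 * s\<close>, so that the total error remains linear in
    \<open>s\<close>.\<close>
  have tD: "norm (transpose D) \<le> 4 * s" "norm (transpose D) \<le> 2"
    using D D2 by (simp_all add: norm_transpose)
  have "norm (bfgs_inverse_update K u v - mat 1 - P ** E ** P)
    \<le> norm (D ** E ** P) + norm (P ** E ** transpose D) + norm (D ** E ** transpose D)
       + (norm (D ** P) + norm (P ** transpose D) + norm (D ** transpose D)) + norm F"
    unfolding expand by (intro norm_triangle_mono order_refl)
  also have "\<dots> \<le> (4 * s) * norm E * p + p * norm E * (4 * s) + (4 * s) * norm E * 2
       + ((4 * s) * p + p * (4 * s) + (4 * s) * 2) + 2 * s"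
    by (intro add_mono mm P D D2 tD Fle order_refl)
  also have "\<dots> \<le> 4 * (2 * p + 3) * s * (1 + norm E)"
    using s by (simp add: algebra_simps)
  finally show ?thesis
    by (simp add: P_def E_def p_def algebra_simps)
qed

lemma symmetric_inverse:
  fixes A K :: "real^'n^'n"
  assumes "K ** A = mat 1" "transpose A = A"
  shows "transpose K = K"
proof -
  have "A ** K = mat 1" using assms(1) matrix_left_right_inverse by blast
  then have "transpose K ** A = mat 1"
    using assms(2) by (metis matrix_transpose_mul transpose_mat)
  then show ?thesis
    using \<open>A ** K = mat 1\<close> by (metis matrix_mul_assoc matrix_mul_lid matrix_mul_rid)
qed

text \<open>The case in which the averaged residual part is the identity. Multiplying the linearized
  iteration by the inverse of \<open>\<Lambda> k\<close> turns it into the relation between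
  \<open>E\<close>, the step and the next gradient that \<open>quasi_newton_gradient_decay\<close>
  requires.\<close>

lemma bfgs_identity_superlinear:
  fixes e u v :: "nat \<Rightarrow> real^'n" and \<Lambda> :: "nat \<Rightarrow> real^'n^'n" and \<sigma> :: "nat \<Rightarrow> real"
  assumes G: "transpose G = G" "pos_def G"
    and lim: "e \<longlonglongrightarrow> 0" and u_def: "\<And>k. u k = e (Suc k) - e k"
    and \<Lambda>0: "transpose (\<Lambda> 0) = \<Lambda> 0" "invertible (\<Lambda> 0)"
    and bfgs: "\<And>k. \<Lambda> (Suc k) = bfgs_update (\<Lambda> k) (u k) (v k)"
    and nz: "\<And>k. u k \<bullet> (\<Lambda> k *v u k) \<noteq> 0" "\<And>k. u k \<bullet> v k \<noteq> 0"
    and \<sigma>: "\<And>k. 0 \<le> \<sigma> k" "summable \<sigma>"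
    and secant: "\<And>k. k0 \<le> k \<Longrightarrow> norm (v k - u k) \<le> \<sigma> k * norm (u k)"
    and step: "\<And>k. k0 \<le> k \<Longrightarrow> norm (G *v e k + (G - mat 1 + \<Lambda> k) *v u k) \<le> \<sigma> k * (norm (u k) + norm (e k))"
    and \<delta>: "0 < \<delta>"
  shows "\<exists>K. \<forall>k\<ge>K. norm (e (Suc k)) \<le> \<delta> * norm (e k)"
proof -
  \<comment> \<open>The inverses are generated by the recursion, so that the update estimate applies
    by definition; that they invert \<open>\<Lambda> k\<close> follows by induction.\<close>
  define K where "K = rec_nat (matrix_inv (\<Lambda> 0)) (\<lambda>k X. bfgs_inverse_update X (u k) (v k))"
  have KS: "K (Suc k) = bfgs_inverse_update (K k) (u k) (v k)" for k by (simp add: K_def)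
  have sym: "transpose (\<Lambda> k) = \<Lambda> k" for k
    by (induction k) (simp_all add: \<Lambda>0 bfgs transpose_bfgs_update)
  have K\<Lambda>: "K k ** \<Lambda> k = mat 1" for k
  proof (induction k)
    case 0
    show ?case using \<Lambda>0(2) by (simp add: K_def matrix_inv_inverse)
  next
    case (Suc k)
    show ?case unfolding KS bfgs by (rule bfgs_inverse_update_inverse[OF Suc sym nz])
  qed
  have symK: "transpose (K k) = K k" for k using K\<Lambda> sym by (rule symmetric_inverse)
  have u0: "u k \<noteq> 0" for k using nz(2)[of k] by auto
  define E where "E k = K k - mat 1" for k
  have symE: "transpose (E k) = E k" for k by (simp add: E_def transpose_diff symK)
  obtain m where m: "0 < m" "\<And>x. m * (norm x)\<^sup>2 \<le> x \<bullet> (G *v x)"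
    using pos_def_coercive[OF G(2)] by blast
  have g_ge: "m * norm x \<le> norm (G *v x)" for x
    using m(2) by (rule coercive_norm_le)
  define C1 where "C1 = 4 * (2 * norm (mat 1 :: real^'n^'n) + 5)"
  define C2 where "C2 = 2 + 1 / m"
  have C: "0 \<le> C1" "0 \<le> C2" using m(1) by (auto simp: C1_def C2_def)
  define \<tau> where "\<tau> k = (C1 + C2) * \<sigma> k" for k
  have \<tau>: "0 \<le> \<tau> k" "summable \<tau>" "C1 * \<sigma> k \<le> \<tau> k" "C2 * \<sigma> k \<le> \<tau> k" for k
    using C \<sigma> by (auto simp: \<tau>_def[abs_def] distrib_right intro: summable_add summable_mult)
  have "eventually (\<lambda>k. \<sigma> k < 1/2) sequentially"
    using summable_LIMSEQ_zero[OF \<sigma>(2)] by (rule order_tendstoD) simp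
  then obtain k1 where k1: "\<And>k. k1 \<le> k \<Longrightarrow> \<sigma> k < 1/2"
    by (auto simp: eventually_sequentially)
  have upd: "norm (E (Suc k) - orth_proj (u k) ** E k ** orth_proj (u k)) \<le> \<tau> k * (1 + norm (E k))"
    if "k0 \<le> k" "k1 \<le> k" for k
  proof -
    have "norm (E (Suc k) - orth_proj (u k) ** E k ** orth_proj (u k)) \<le> C1 * \<sigma> k * (1 + norm (E k))"
      unfolding E_def KS C1_def
      using bfgs_inverse_update_estimate[OF u0 secant \<sigma>(1)] k1[OF that(2)] that(1) by simp
    also have "\<dots> \<le> \<tau> k * (1 + norm (E k))" using \<tau>(3) by (intro mult_right_mono) auto
    finally show ?thesis .
  qed
  have eq: "norm (G *v e (Suc k) + E k *v (G *v e (Suc k)) - E k *v u k)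
              \<le> \<tau> k * (1 + norm (E k)) * (norm (u k) + norm (G *v e (Suc k)))"
    if "k0 \<le> k" for k
  proof -
    define g where "g = G *v e (Suc k)"
    define \<rho> where "\<rho> = G *v e k + (G - mat 1 + \<Lambda> k) *v u k"
    have "g = u k - \<Lambda> k *v u k + \<rho>"
      by (simp add: g_def \<rho>_def u_def matrix_vector_mult_add_rdistrib matrix_vector_mult_diff_rdistrib
          matrix_vector_mult_diff_distrib)
    \<comment> \<open>Multiplication by the inverse turns the unbounded candidate
      \<open>\<Lambda> k\<close> into the controlled matrix \<open>E k\<close>; the remainder
      \<open>\<rho>\<close> is amplified by \<open>1 + norm (E k)\<close> at most.\<close>
    then have "K k *v g = K k *v u k - u k + K k *v \<rho>"
      by (simp add: matrix_vector_right_distrib matrix_vector_mult_diff_distrib matrix_vector_mul_assoc K\<Lambda>)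
    then have *: "g + E k *v g - E k *v u k = \<rho> + E k *v \<rho>"
      by (simp add: E_def matrix_vector_mult_diff_rdistrib)
    \<comment> \<open>The remainder is measured by the current error, whereas the decay lemma admits
      only the step and the next gradient. The triangle inequality and coercivity of
      \<open>G\<close> convert one into the other, at the price of \<open>C2\<close>.\<close>
    have "norm (e k) \<le> norm (u k) + norm g / m"
    proof -
      have "norm (e k) \<le> norm (u k) + norm (e (Suc k))"
        using norm_triangle_ineq4[of "e (Suc k)" "u k"] by (simp add: u_def)
      moreover have "norm (e (Suc k)) \<le> norm g / m"
        using g_ge[of "e (Suc k)"] m(1) by (simp add: g_def field_simps)
      ultimately show ?thesis by linarith
    qed
    moreover have "norm (u k) * (1 / m) + norm g * 2 \<ge> 0" using m(1) by simp
    moreover have "C2 * (norm (u k) + norm g) = norm (u k) * 2 + norm g / m + (norm (u k) * (1 / m) + norm g * 2)"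
      by (simp add: C2_def algebra_simps)
    ultimately have ue: "norm (u k) + norm (e k) \<le> C2 * (norm (u k) + norm g)"
      by linarith
    have "norm \<rho> \<le> \<sigma> k * (norm (u k) + norm (e k))" unfolding \<rho>_def by (rule step[OF that])
    also have "\<dots> \<le> \<sigma> k * (C2 * (norm (u k) + norm g))" using ue \<sigma>(1) by (intro mult_left_mono) auto
    also have "\<dots> \<le> \<tau> k * (norm (u k) + norm g)"
      using mult_right_mono[OF \<tau>(4)[of k], of "norm (u k) + norm g"] by (simp add: mult_ac)
    finally have \<rho>: "norm \<rho> \<le> \<tau> k * (norm (u k) + norm g)" .
    have "norm (\<rho> + E k *v \<rho>) \<le> norm \<rho> + norm (E k) * norm \<rho>"
      by (intro norm_triangle_le add_left_mono norm_matrix_vector_mult_le)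
    also have "\<dots> = (1 + norm (E k)) * norm \<rho>" by (simp add: algebra_simps)
    also have "\<dots> \<le> (1 + norm (E k)) * (\<tau> k * (norm (u k) + norm g))"
      using \<rho> by (intro mult_left_mono) auto
    finally show ?thesis unfolding g_def[symmetric] * by (simp add: mult_ac)
  qed
  define j where "j = max k0 k1"
  \<comment> \<open>The threshold is solved backwards: coercivity costs \<open>m\<close>, and
    \<open>norm (u k)\<close> is at most the sum of two consecutive errors, so the factor
    \<open>\<delta> / (1 + \<delta>)\<close> yields exactly \<open>\<delta>\<close> once the newer
    error is absorbed. The shift by \<open>j\<close> discards the steps before the estimates
    hold.\<close>
  have "\<exists>K. \<forall>k\<ge>K. norm (G *v e (Suc k + j)) \<le> m * \<delta> / (1 + \<delta>) * norm (u (k + j))"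
  proof (rule quasi_newton_gradient_decay[OF G, where E = "\<lambda>k. E (k + j)" and \<sigma> = "\<lambda>k. \<tau> (k + j)",
        where e = "\<lambda>k. e (k + j)" and u = "\<lambda>k. u (k + j)"])
    show "(\<lambda>k. e (k + j)) \<longlonglongrightarrow> 0" by (rule LIMSEQ_ignore_initial_segment[OF lim])
    show "summable (\<lambda>k. \<tau> (k + j))" using \<tau>(2) by (rule summable_ignore_initial_segment)
    show "0 < m * \<delta> / (1 + \<delta>)" using m(1) \<delta> by simp
    show "norm (E (Suc k + j) - orth_proj (u (k + j)) ** E (k + j) ** orth_proj (u (k + j)))
            \<le> \<tau> (k + j) * (1 + norm (E (k + j)))" for k
      using upd[of "k + j"] by (simp add: j_def)
    show "norm (G *v e (Suc k + j) + E (k + j) *v (G *v e (Suc k + j)) - E (k + j) *v u (k + j))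
         \<le> \<tau> (k + j) * (1 + norm (E (k + j))) * (norm (u (k + j)) + norm (G *v e (Suc k + j)))" for k
      using eq[of "k + j"] by (simp add: j_def)
  qed (use u0 symE \<tau>(1) in \<open>auto simp: u_def\<close>)
  then obtain L where L: "\<And>k. L \<le> k \<Longrightarrow> norm (G *v e (Suc k + j)) \<le> m * \<delta> / (1 + \<delta>) * norm (u (k + j))"
    by blast
  have "norm (e (Suc k)) \<le> \<delta> * norm (e k)" if "L + j \<le> k" for k
  proof -
    have "norm (G *v e (Suc k)) \<le> m * \<delta> / (1 + \<delta>) * norm (u k)"
      using L[of "k - j"] that by simp
    also have "\<dots> \<le> m * \<delta> / (1 + \<delta>) * (norm (e (Suc k)) + norm (e k))"
      unfolding u_def using m(1) \<delta> by (intro mult_left_mono norm_triangle_ineq4) auto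
    finally have "m * norm (e (Suc k)) \<le> m * (\<delta> / (1 + \<delta>) * (norm (e (Suc k)) + norm (e k)))"
      using g_ge[of "e (Suc k)"] by simp
    then have "norm (e (Suc k)) \<le> \<delta> / (1 + \<delta>) * (norm (e (Suc k)) + norm (e k))"
      using m(1) by (rule mult_left_le_imp_le)
    then have "norm (e (Suc k)) * (1 + \<delta>) \<le> \<delta> * (norm (e (Suc k)) + norm (e k))"
      using \<delta> by (simp add: field_simps)
    then show ?thesis by (simp add: algebra_simps)
  qed
  then show ?thesis by blast
qed

section \<open>Reduction of a positive definite residual part to the identity by congruence\<close>

lemma pos_def_normalizing_transformation:
  fixes A :: "real^'n^'n"
  assumes sym: "transpose A = A" and pd: "pos_def A"
  obtains T :: "real^'n^'n" where "transpose T ** A ** T = mat 1"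
proof -
  \<comment> \<open>Gram-Schmidt for the inner product given by \<open>A\<close>: fewer than
    \<open>CARD('n)\<close> vectors \<open>A *v f i\<close> leave a nonzero vector orthogonal to all
    of them, which is then normalized.\<close>
  have "\<exists>f :: nat \<Rightarrow> real^'n. \<forall>i<n. \<forall>j<n. f i \<bullet> (A *v f j) = (if i = j then 1 else 0)"
    if "n \<le> CARD('n)" for n
    using that
  proof (induction n)
    case (Suc n)
    then obtain f :: "nat \<Rightarrow> real^'n"
      where f: "\<And>i j. i < n \<Longrightarrow> j < n \<Longrightarrow> f i \<bullet> (A *v f j) = (if i = j then 1 else 0)"
      by auto
    define S where "S = (\<lambda>i. A *v f i) ` {..<n}"
    have "dim S \<le> card S" by (rule dim_le_card') (simp add: S_def)
    also have "\<dots> \<le> n" unfolding S_def using card_image_le[of "{..<n}"] by simp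
    finally have "dim S < DIM(real^'n)" using Suc.prems by simp
    then obtain x where x: "x \<noteq> 0" "\<And>z. z \<in> span S \<Longrightarrow> orthogonal x z"
      using orthogonal_to_subspace_exists by blast
    define q where "q = x \<bullet> (A *v x)"
    have q: "0 < q" using pd x(1) by (simp add: q_def pos_def_def)
    define y where "y = (1 / sqrt q) *\<^sub>R x"
    have yy: "y \<bullet> (A *v y) = 1"
      using q by (simp add: y_def matrix_vector_mult_scaleR flip: q_def)
    have yf: "y \<bullet> (A *v f i) = 0" if "i < n" for i
      using x(2)[of "A *v f i"] that by (simp add: y_def S_def span_base orthogonal_def)
    have fy: "f i \<bullet> (A *v y) = 0" if "i < n" for i
      using yf[OF that] symmetric_matrix_inner[OF sym, of "f i" y] by (simp add: inner_commute)
    show ?case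
      using f yy yf fy by (intro exI[of _ "f(n := y)"]) (auto simp: less_Suc_eq)
  qed auto
  then obtain f :: "nat \<Rightarrow> real^'n"
    where f: "\<And>i j. i < CARD('n) \<Longrightarrow> j < CARD('n) \<Longrightarrow> f i \<bullet> (A *v f j) = (if i = j then 1 else 0)"
    by blast
  obtain h :: "'n \<Rightarrow> nat" where h: "bij_betw h UNIV {0..<CARD('n)}"
    using ex_bij_betw_finite_nat[of "UNIV :: 'n set"] by auto
  have hlt: "h i < CARD('n)" for i using h by (auto simp: bij_betw_def)
  have hinj: "h i = h j \<longleftrightarrow> i = j" for i j using h by (auto simp: bij_betw_def inj_on_def)
  define T :: "real^'n^'n" where "T = transpose (\<chi> j. f (h j))"
  have "(transpose T ** A ** T) $ i $ j = f (h i) \<bullet> (A *v f (h j))" for i j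
  proof -
    have "T *v axis j 1 = f (h j)" for j
      by (simp add: T_def matrix_vector_mult_basis column_def transpose_def vec_eq_iff)
    moreover have "(transpose T ** A ** T) $ i $ j = axis i 1 \<bullet> ((transpose T ** A ** T) *v axis j 1)"
      by (simp add: inner_axis' matrix_vector_mult_basis column_def)
    ultimately show ?thesis
      by (metis dot_lmul_matrix matrix_vector_mul_assoc transpose_transpose transpose_matrix_vector)
  qed
  then have "transpose T ** A ** T = mat 1"
    by (simp add: vec_eq_iff f hlt hinj mat_def)
  then show ?thesis by (rule that)
qed

lemma outer_congruence:
  fixes T :: "real^'n^'n"
  shows "transpose T ** outer x y ** T = outer (transpose T *v x) (transpose T *v y)"
proof -
  have "(transpose T *v y) \<bullet> w = y \<bullet> (T *v w)" for w
    using transpose_mult_inner[of w T y] by (simp add: inner_commute)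
  then show ?thesis
    by (simp add: matrix_eq outer_mult_vector matrix_vector_mult_scaleR
        del: transpose_matrix_vector flip: matrix_vector_mul_assoc)
qed

text \<open>BFGS is invariant under linear changes of variables. Steps transform by the inverse
  \<open>R\<close> of \<open>T\<close> and gradient differences by the transpose of
  \<open>T\<close>, so both scalar denominators are unchanged.\<close>

lemma bfgs_update_congruence:
  fixes T R :: "real^'n^'n"
  assumes "T ** R = mat 1"
  shows "bfgs_update (transpose T ** B ** T) (R *v u) (transpose T *v v)
     = transpose T ** bfgs_update B u v ** T"
proof -
  have TR: "T *v (R *v x) = x" for x using assms by (simp add: matrix_vector_mul_assoc)
  have 1: "(transpose T ** B ** T) *v (R *v u) = transpose T *v (B *v u)"
    by (simp add: TR flip: matrix_vector_mul_assoc del: transpose_matrix_vector)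
  have 2: "(R *v u) \<bullet> (transpose T *v x) = u \<bullet> x" for x
    unfolding transpose_mult_inner TR ..
  show ?thesis
    unfolding bfgs_update_def 1 2
    by (simp add: matrix_add_ldistrib matrix_add_rdistrib matrix_diff_ldistrib matrix_diff_rdistrib
        matrix_scalar_ac outer_congruence del: transpose_matrix_vector flip: scalar_matrix_assoc)
qed

lemma bfgs_superlinear:
  fixes e u v :: "nat \<Rightarrow> real^'n" and \<Lambda> :: "nat \<Rightarrow> real^'n^'n" and \<sigma> :: "nat \<Rightarrow> real"
  assumes G: "transpose G = G" "pos_def G" and P: "transpose P = P" "pos_def P"
    and lim: "e \<longlonglongrightarrow> 0" and u_def: "\<And>k. u k = e (Suc k) - e k"
    and \<Lambda>0: "transpose (\<Lambda> 0) = \<Lambda> 0" "invertible (\<Lambda> 0)"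
    and bfgs: "\<And>k. \<Lambda> (Suc k) = bfgs_update (\<Lambda> k) (u k) (v k)"
    and nz: "\<And>k. u k \<bullet> (\<Lambda> k *v u k) \<noteq> 0" "\<And>k. u k \<bullet> v k \<noteq> 0"
    and \<sigma>: "\<And>k. 0 \<le> \<sigma> k" "summable \<sigma>"
    and secant: "\<And>k. k0 \<le> k \<Longrightarrow> norm (v k - P *v u k) \<le> \<sigma> k * norm (u k)"
    and step: "\<And>k. k0 \<le> k \<Longrightarrow> norm (G *v e k + (G - P + \<Lambda> k) *v u k) \<le> \<sigma> k * (norm (u k) + norm (e k))"
    and \<delta>: "0 < \<delta>"
  shows "\<exists>K. \<forall>k\<ge>K. norm (e (Suc k)) \<le> \<delta> * norm (e k)"
proof -
  obtain T :: "real^'n^'n" where T: "transpose T ** P ** T = mat 1"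
    using P by (rule pos_def_normalizing_transformation)
  \<comment> \<open>\<open>R\<close> is the inverse of \<open>T\<close> and also sends
    \<open>x\<close> to the transformed \<open>P *v x\<close>. Hence \<open>v\<close> close to
    \<open>P *v u\<close> becomes a vector close to the transformed step.\<close>
  define R where "R = transpose T ** P"
  have RT: "R ** T = mat 1" using T by (simp add: R_def)
  then have TR: "T ** R = mat 1" using matrix_left_right_inverse by blast
  have TRv: "T *v (R *v x) = x" and RTv: "R *v (T *v x) = x" for x
    using TR RT by (simp_all add: matrix_vector_mul_assoc)
  have T0: "T *v x \<noteq> 0" if "x \<noteq> 0" for x using RTv[of x] that by auto
  have sym: "transpose (transpose T ** A ** T) = transpose T ** A ** T" if "transpose A = A" for A :: "real^'n^'n"
    by (simp add: matrix_transpose_mul that matrix_mul_assoc)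
  have form: "x \<bullet> ((transpose T ** A ** T) *v y) = (T *v x) \<bullet> (A *v (T *v y))" for A :: "real^'n^'n" and x y
    by (simp add: transpose_mult_inner del: transpose_matrix_vector flip: matrix_vector_mul_assoc)
  have pd: "pos_def (transpose T ** G ** T)"
    using G(2) T0 unfolding pos_def_def form by blast
  have inv: "invertible (transpose T ** \<Lambda> 0 ** T)"
  proof -
    have "invertible T" using TR RT unfolding invertible_def by blast
    then show ?thesis using \<Lambda>0(2) by (intro invertible_mult transpose_invertible)
  qed
  define b where "b = norm T"
  have nT: "norm (T *v x) \<le> b * norm x" and ntT: "norm (transpose T *v x) \<le> b * norm x" for x
    unfolding b_def using norm_matrix_vector_mult_le[of T x] norm_matrix_vector_mult_le[of "transpose T" x]
    by (simp_all add: norm_transpose del: transpose_matrix_vector)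
  have b0: "0 \<le> b" by (simp add: b_def)
  have nu: "norm x \<le> b * norm (R *v x)" for x using nT[of "R *v x"] by (simp add: TRv)
  have RP: "transpose T *v (P *v x) = R *v x" for x
    by (simp add: R_def del: transpose_matrix_vector flip: matrix_vector_mul_assoc)
  \<comment> \<open>The change of variables distorts a ratio of errors by at most
    \<open>b * norm R\<close>; the summand 1 makes the denominator visibly positive.\<close>
  have "0 < \<delta> / (b * norm R + 1)" using \<delta> b0 by (simp add: add_nonneg_pos)
  then have "\<exists>K. \<forall>k\<ge>K. norm (R *v e (Suc k)) \<le> \<delta> / (b * norm R + 1) * norm (R *v e k)"
  proof (rule bfgs_identity_superlinear[OF sym[OF G(1)] pd, where \<Lambda> = "\<lambda>k. transpose T ** \<Lambda> k ** T"
        and e = "\<lambda>k. R *v e k" and u = "\<lambda>k. R *v u k" and v = "\<lambda>k. transpose T *v v k"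
        and \<sigma> = "\<lambda>k. b\<^sup>2 * \<sigma> k" and ?k0.0 = k0, rotated -1])
    show "(\<lambda>k. R *v e k) \<longlonglongrightarrow> 0"
      using bounded_linear.tendsto[OF matrix_vector_mul_bounded_linear lim, of R] by simp
    show "R *v u k = R *v e (Suc k) - R *v e k" for k
      by (simp add: u_def matrix_vector_mult_diff_distrib)
    show "transpose (transpose T ** \<Lambda> 0 ** T) = transpose T ** \<Lambda> 0 ** T" by (rule sym[OF \<Lambda>0(1)])
    show "invertible (transpose T ** \<Lambda> 0 ** T)" by (rule inv)
    show "transpose T ** \<Lambda> (Suc k) ** T = bfgs_update (transpose T ** \<Lambda> k ** T) (R *v u k) (transpose T *v v k)" for k
      unfolding bfgs by (rule bfgs_update_congruence[OF TR, symmetric])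
    show "(R *v u k) \<bullet> ((transpose T ** \<Lambda> k ** T) *v (R *v u k)) \<noteq> 0" for k
      unfolding form TRv by (rule nz)
    show "(R *v u k) \<bullet> (transpose T *v v k) \<noteq> 0" for k
      unfolding transpose_mult_inner TRv by (rule nz)
    show "0 \<le> b\<^sup>2 * \<sigma> k" for k using \<sigma>(1) by simp
    show "summable (\<lambda>k. b\<^sup>2 * \<sigma> k)" using \<sigma>(2) by (rule summable_mult)
  next
    fix k assume k: "k0 \<le> k"
    have "norm (transpose T *v v k - R *v u k) = norm (transpose T *v (v k - P *v u k))"
      by (simp add: matrix_vector_mult_diff_distrib RP del: transpose_matrix_vector)
    also have "\<dots> \<le> b * (\<sigma> k * norm (u k))"
      using mult_left_mono[OF secant[OF k] b0] by (rule order_trans[OF ntT])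
    also have "\<dots> \<le> b * (\<sigma> k * (b * norm (R *v u k)))"
      using b0 \<sigma>(1) nu by (intro mult_left_mono) auto
    finally show "norm (transpose T *v v k - R *v u k) \<le> b\<^sup>2 * \<sigma> k * norm (R *v u k)"
      by (simp add: power2_eq_square mult_ac)
  next
    fix k assume k: "k0 \<le> k"
    have "(transpose T ** G ** T) *v (R *v e k) + (transpose T ** G ** T - mat 1 + transpose T ** \<Lambda> k ** T) *v (R *v u k)
       = transpose T *v (G *v e k + (G - P + \<Lambda> k) *v u k)"
      by (simp add: matrix_vector_mult_add_rdistrib matrix_vector_mult_diff_rdistrib matrix_vector_right_distrib
          matrix_vector_mult_diff_distrib RP TRv del: transpose_matrix_vector flip: matrix_vector_mul_assoc)
    then have "norm ((transpose T ** G ** T) *v (R *v e k) + (transpose T ** G ** T - mat 1 + transpose T ** \<Lambda> k ** T) *v (R *v u k))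
       \<le> b * (\<sigma> k * (norm (u k) + norm (e k)))"
      using mult_left_mono[OF step[OF k] b0] by (simp only: order_trans[OF ntT])
    also have "\<dots> \<le> b * (\<sigma> k * (b * norm (R *v u k) + b * norm (R *v e k)))"
      using b0 \<sigma>(1) nu by (intro mult_left_mono add_mono) auto
    finally show "norm ((transpose T ** G ** T) *v (R *v e k) + (transpose T ** G ** T - mat 1 + transpose T ** \<Lambda> k ** T) *v (R *v u k))
       \<le> b\<^sup>2 * \<sigma> k * (norm (R *v u k) + norm (R *v e k))"
      by (simp add: power2_eq_square algebra_simps)
  qed
  then obtain K where K: "\<And>k. K \<le> k \<Longrightarrow> norm (R *v e (Suc k)) \<le> \<delta> / (b * norm R + 1) * norm (R *v e k)"
    by blast
  have "norm (e (Suc k)) \<le> \<delta> * norm (e k)" if "K \<le> k" for k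
  proof -
    have "norm (e (Suc k)) \<le> b * norm (R *v e (Suc k))" by (rule nu)
    also have "\<dots> \<le> b * (\<delta> / (b * norm R + 1) * (norm R * norm (e k)))"
      using b0 \<delta> by (intro mult_left_mono order_trans[OF K[OF that] mult_left_mono[OF norm_matrix_vector_mult_le]]) auto
    also have "\<dots> = (b * norm R) / (b * norm R + 1) * (\<delta> * norm (e k))" by simp
    also have "\<dots> \<le> 1 * (\<delta> * norm (e k))"
      using b0 \<delta> by (intro mult_right_mono) (auto simp: divide_le_eq_1 add_nonneg_pos)
    finally show ?thesis by simp
  qed
  then show ?thesis by blast
qed

subsection \<open>Second derivatives of composite objectives\<close>

lemma linear_inner_axis:
  fixes D :: "real^'n \<Rightarrow> real"
  assumes "linear D"
  shows "D h = (\<chi> a. D (axis a 1)) \<bullet> h"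
proof -
  have "D h = D (\<Sum>a\<in>UNIV. h $ a *\<^sub>R axis a 1)"
    using basis_expansion[of h] by (simp add: scalar_mult_eq_scaleR)
  also have "\<dots> = (\<Sum>a\<in>UNIV. h $ a * D (axis a 1))"
    using assms by (simp add: linear_sum linear_scale)
  finally show ?thesis by (simp add: inner_vec_def mult.commute)
qed

lemma has_derivative_grad:
  assumes "g differentiable (at x)"
  shows "(g has_derivative (\<lambda>h. grad g x \<bullet> h)) (at x)"
proof -
  have "(g has_derivative frechet_derivative g (at x)) (at x)"
    using assms by (simp add: frechet_derivative_works)
  moreover have "frechet_derivative g (at x) = (\<lambda>h. grad g x \<bullet> h)"
    unfolding grad_def by (rule ext) (rule linear_inner_axis[OF linear_frechet_derivative[OF assms]])
  ultimately show ?thesis by simp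
qed

lemma grad_eqI:
  assumes "(g has_derivative (\<lambda>h. c \<bullet> h)) (at x)"
  shows "grad g x = c"
  by (simp add: grad_def inner_axis vec_eq_iff flip: frechet_derivative_at[OF assms])

text \<open>The first index of \<open>hess\<close> is the direction of differentiation, so it is the
  transpose of the derivative matrix of the gradient. The transpose disappears after
  \<open>transpose_hess\<close>.\<close>

lemma hess_eqI:
  assumes "(grad g has_derivative (\<lambda>h. A *v h)) (at x)"
  shows "hess g x = transpose A"
proof -
  have "((\<lambda>z. grad g z $ b) has_derivative (\<lambda>h. (A *v h) $ b)) (at x)" for b
    using bounded_linear.has_derivative[OF bounded_linear_vec_nth assms] .
  from frechet_derivative_at[OF this, symmetric] show ?thesis
    by (simp add: hess_def transpose_def vec_eq_iff matrix_vector_mult_basis column_def)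
qed

text \<open>The mean value theorem along \<open>h\<close> replaces the second difference by a
  difference of gradients at two points near \<open>x\<close>, and \<open>A\<close> describes each
  of them relative to \<open>x\<close>. Differentiability of the gradient at this one point is
  enough.\<close>

lemma second_difference_estimate:
  fixes g :: "real^'n \<Rightarrow> real"
  assumes g: "\<And>x. g differentiable (at x)"
    and A: "\<And>z. norm z < d \<Longrightarrow> norm (grad g (x + z) - grad g x - A *v z) \<le> \<epsilon> * norm z"
    and t: "0 < t" "t * (norm h + norm k) < d" and \<epsilon>: "0 < \<epsilon>"
  shows "\<bar>g (x + t *\<^sub>R h + t *\<^sub>R k) - g (x + t *\<^sub>R h) - g (x + t *\<^sub>R k) + g x - t\<^sup>2 * (h \<bullet> (A *v k))\<bar>
     \<le> 2 * \<epsilon> * t\<^sup>2 * (norm h + norm k)\<^sup>2"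
proof -
  define \<phi> where "\<phi> s = g (x + (s * t) *\<^sub>R h + t *\<^sub>R k) - g (x + (s * t) *\<^sub>R h)" for s
  define p where "p s = grad g (x + (s * t) *\<^sub>R h + t *\<^sub>R k) - grad g (x + (s * t) *\<^sub>R h)" for s
  define n where "n = norm h + norm k"
  have D: "((\<lambda>s. g (x + (s * t) *\<^sub>R h + c)) has_derivative
      (\<lambda>r. grad g (x + (s * t) *\<^sub>R h + c) \<bullet> ((r * t) *\<^sub>R h))) (at s within S)" for s c S
  proof -
    have "((\<lambda>s. x + (s * t) *\<^sub>R h + c) has_derivative (\<lambda>r. (r * t) *\<^sub>R h)) (at s within S)"
      by (auto intro!: derivative_eq_intros)
    from has_derivative_compose[OF this has_derivative_grad[OF g]] show ?thesis .
  qed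
  have "(\<phi> has_derivative (\<lambda>r. p s \<bullet> ((r * t) *\<^sub>R h))) (at s within {0..1})" for s
    unfolding \<phi>_def[abs_def] p_def inner_diff_left
    using has_derivative_diff[OF D[of "t *\<^sub>R k" s] D[of 0 s]] by simp
  then obtain s where s: "s \<in> {0<..<1}" "\<phi> 1 - \<phi> 0 = p s \<bullet> (t *\<^sub>R h)"
    using mvt_simple[of 0 1 \<phi> "\<lambda>s r. p s \<bullet> ((r * t) *\<^sub>R h)"] by auto
  define z1 where "z1 = (s * t) *\<^sub>R h + t *\<^sub>R k"
  define z2 where "z2 = (s * t) *\<^sub>R h"
  have sh: "norm z2 \<le> t * norm h"
    using s(1) t(1) by (simp add: z2_def abs_mult mult_left_le_one_le mult.assoc)
  have z1: "norm z1 \<le> t * n"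
    using norm_triangle_ineq[of z2 "t *\<^sub>R k"] sh t(1) by (simp add: z1_def z2_def n_def algebra_simps)
  have z2: "norm z2 \<le> t * n"
    using sh t(1) by (simp add: n_def distrib_left add_increasing2)
  have "norm (p s - A *v (t *\<^sub>R k)) \<le> \<epsilon> * norm z1 + \<epsilon> * norm z2"
  proof -
    \<comment> \<open>The unknown intermediate parameter \<open>s\<close> drops out, because the
      displacements \<open>z1\<close> and \<open>z2\<close> differ by \<open>t *\<^sub>R k\<close>
      alone.\<close>
    have "p s - A *v (t *\<^sub>R k) = (grad g (x + z1) - grad g x - A *v z1) - (grad g (x + z2) - grad g x - A *v z2)"
      by (simp add: p_def z1_def z2_def matrix_vector_right_distrib add.assoc)
    also have "norm \<dots> \<le> \<epsilon> * norm z1 + \<epsilon> * norm z2"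
      using z1 z2 t(2) by (intro norm_triangle_le_diff add_mono A) (auto simp: n_def)
    finally show ?thesis .
  qed
  also have "\<dots> \<le> \<epsilon> * (t * n) + \<epsilon> * (t * n)"
    using z1 z2 \<epsilon> by (intro add_mono mult_left_mono) auto
  finally have p: "norm (p s - A *v (t *\<^sub>R k)) \<le> 2 * \<epsilon> * t * n" by (simp add: mult_ac)
  have "g (x + t *\<^sub>R h + t *\<^sub>R k) - g (x + t *\<^sub>R h) - g (x + t *\<^sub>R k) + g x - t\<^sup>2 * (h \<bullet> (A *v k))
    = \<phi> 1 - \<phi> 0 - (t *\<^sub>R h) \<bullet> (A *v (t *\<^sub>R k))"
    by (simp add: \<phi>_def matrix_vector_mult_scaleR power2_eq_square)
  also have "\<dots> = (p s - A *v (t *\<^sub>R k)) \<bullet> (t *\<^sub>R h)"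
    unfolding s(2) inner_diff_left by (simp add: inner_commute)
  finally have "\<bar>g (x + t *\<^sub>R h + t *\<^sub>R k) - g (x + t *\<^sub>R h) - g (x + t *\<^sub>R k) + g x - t\<^sup>2 * (h \<bullet> (A *v k))\<bar>
    \<le> norm (p s - A *v (t *\<^sub>R k)) * norm (t *\<^sub>R h)"
    by (simp only: Cauchy_Schwarz_ineq2)
  also have "\<dots> \<le> (2 * \<epsilon> * t * n) * (t * n)"
    using p t(1) \<epsilon> by (intro mult_mono) (auto simp: n_def)
  finally show ?thesis by (simp add: n_def power2_eq_square mult_ac)
qed

text \<open>The second difference is symmetric in \<open>h\<close> and \<open>k\<close>, and divided
  by the square of \<open>t\<close> it approximates both bilinear forms. Their difference is
  therefore smaller than every positive number.\<close>

lemma transpose_hess: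
  fixes g :: "real^'n \<Rightarrow> real"
  assumes g: "twice_differentiable g"
  shows "transpose (hess g x) = hess g x"
proof -
  have g1: "g differentiable (at x)" for x using g by (simp add: twice_differentiable_def)
  obtain D where D: "(grad g has_derivative D) (at x)"
    using g by (auto simp: twice_differentiable_def differentiable_def)
  define A where "A = matrix D"
  have DA: "D = (\<lambda>h. A *v h)"
    unfolding A_def using has_derivative_linear[OF D] by (simp add: fun_eq_iff matrix_works)
  have h: "hess g x = transpose A" using D unfolding DA by (rule hess_eqI)
  have sym: "h \<bullet> (A *v k) = k \<bullet> (A *v h)" for h k
  proof -
    define n where "n = norm h + norm k"
    have "\<bar>h \<bullet> (A *v k) - k \<bullet> (A *v h)\<bar> \<le> 4 * \<epsilon> * n\<^sup>2" if \<epsilon>: "0 < \<epsilon>" for \<epsilon>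
    proof -
      obtain d where d: "0 < d" "\<And>y. norm (y - x) < d \<Longrightarrow>
          norm (grad g y - grad g x - A *v (y - x)) \<le> \<epsilon> * norm (y - x)"
        using D \<epsilon> unfolding has_derivative_at_alt DA by blast
      have d': "norm (grad g (x + z) - grad g x - A *v z) \<le> \<epsilon> * norm z" if "norm z < d" for z
        using d(2)[of "x + z"] that by simp
      define t where "t = d / (2 * (n + 1))"
      have n: "0 \<le> n" by (simp add: n_def)
      have t: "0 < t" using d(1) n by (simp add: t_def)
      have "t * n \<le> t * (n + 1)" using t by (intro mult_left_mono) auto
      also have "\<dots> = d / 2" using n by (simp add: t_def field_simps)
      finally have tn: "t * (norm h + norm k) < d" "t * (norm k + norm h) < d"
        using d(1) by (simp_all add: n_def add.commute)
      define \<Delta> where "\<Delta> = g (x + t *\<^sub>R h + t *\<^sub>R k) - g (x + t *\<^sub>R h) - g (x + t *\<^sub>R k) + g x"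
      have "\<bar>\<Delta> - t\<^sup>2 * (h \<bullet> (A *v k))\<bar> \<le> 2 * \<epsilon> * t\<^sup>2 * n\<^sup>2"
        unfolding \<Delta>_def n_def by (rule second_difference_estimate[OF g1 d' t tn(1) \<epsilon>])
      moreover have "\<bar>\<Delta> - t\<^sup>2 * (k \<bullet> (A *v h))\<bar> \<le> 2 * \<epsilon> * t\<^sup>2 * n\<^sup>2"
      proof -
        have comm: "x + t *\<^sub>R k + t *\<^sub>R h = x + t *\<^sub>R h + t *\<^sub>R k" "norm k + norm h = n"
          by (simp_all add: n_def)
        have "\<Delta> - t\<^sup>2 * (k \<bullet> (A *v h)) = g (x + t *\<^sub>R h + t *\<^sub>R k) - g (x + t *\<^sub>R k) - g (x + t *\<^sub>R h)
            + g x - t\<^sup>2 * (k \<bullet> (A *v h))"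
          by (simp add: \<Delta>_def)
        then show ?thesis
          using second_difference_estimate[OF g1 d' t tn(2) \<epsilon>] by (simp only: comm)
      qed
      ultimately have "\<bar>t\<^sup>2 * (h \<bullet> (A *v k)) - t\<^sup>2 * (k \<bullet> (A *v h))\<bar> \<le> t\<^sup>2 * (4 * \<epsilon> * n\<^sup>2)"
        unfolding mult.left_commute[of "t\<^sup>2"] by (simp only: abs_le_iff) linarith
      then have "t\<^sup>2 * \<bar>h \<bullet> (A *v k) - k \<bullet> (A *v h)\<bar> \<le> t\<^sup>2 * (4 * \<epsilon> * n\<^sup>2)"
        by (simp add: abs_mult flip: right_diff_distrib)
      then show ?thesis using t by (simp add: mult_le_cancel_left_pos)
    qed
    then have le: "\<bar>h \<bullet> (A *v k) - k \<bullet> (A *v h)\<bar> \<le> \<epsilon> * (4 * n\<^sup>2)" if "0 < \<epsilon>" for \<epsilon>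
      using that by (simp add: mult_ac)
    have "\<bar>h \<bullet> (A *v k) - k \<bullet> (A *v h)\<bar> \<le> 0"
    proof (rule field_le_epsilon)
      fix \<epsilon> :: real assume \<epsilon>: "0 < \<epsilon>"
      have "\<epsilon> / (4 * n\<^sup>2 + 1) * (4 * n\<^sup>2) \<le> \<epsilon>"
        using \<epsilon> by (simp add: field_simps add_pos_nonneg)
      moreover have "0 < \<epsilon> / (4 * n\<^sup>2 + 1)" using \<epsilon> by (simp add: add_nonneg_pos)
      ultimately show "\<bar>h \<bullet> (A *v k) - k \<bullet> (A *v h)\<bar> \<le> 0 + \<epsilon>"
        using le[of "\<epsilon> / (4 * n\<^sup>2 + 1)"] by linarith
    qed
    then show ?thesis by simp
  qed
  have "A $ a $ b = A $ b $ a" for a b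
    using sym[of "axis a 1" "axis b 1"] by (simp add: inner_axis' matrix_vector_mult_basis column_def)
  then have "transpose A = A" by (simp add: vec_eq_iff transpose_def)
  then show ?thesis by (simp add: h)
qed

lemma has_derivative_grad_hess:
  assumes g: "twice_differentiable g"
  shows "(grad g has_derivative (\<lambda>h. hess g x *v h)) (at x)"
proof -
  obtain D where D: "(grad g has_derivative D) (at x)"
    using g by (auto simp: twice_differentiable_def differentiable_def)
  have DA: "D = (\<lambda>h. matrix D *v h)"
    using has_derivative_linear[OF D] by (simp add: fun_eq_iff matrix_works)
  have "hess g x = transpose (matrix D)" using D by (subst (asm) DA) (rule hess_eqI)
  then have "matrix D = hess g x" using transpose_hess[OF g, of x] by simp
  then show ?thesis using D DA by simp
qed

section \<open>Jacobians and the two parts of the Hessian of a composition\<close>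

lemma jac_mult_vector: "jac F t *v p = (\<Sum>j\<in>UNIV. p $ j *\<^sub>R grad (\<lambda>s. F s $ j) t)"
  by (simp add: vec_eq_iff jac_def matrix_vector_mult_def mult.commute)

lemma transpose_jac_mult_vector: "(transpose (jac F t) *v h) $ j = grad (\<lambda>s. F s $ j) t \<bullet> h"
  by (simp add: jac_def vector_matrix_mult_def inner_vec_def mult.commute)

lemma res_part_mult_vector:
  "res_part F L t *v h = (\<Sum>j\<in>UNIV. grad L (F t) $ j *\<^sub>R (hess (\<lambda>s. F s $ j) t *v h))"
  by (simp add: res_part_def vec_eq_iff matrix_vector_mult_def sum_distrib_left sum_distrib_right
      mult.assoc) (auto intro: sum.swap)

lemma has_derivative_jac:
  fixes F :: "real^'n \<Rightarrow> real^'m"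
  assumes F: "\<And>j. twice_differentiable (\<lambda>t. F t $ j)"
  shows "(F has_derivative (\<lambda>h. transpose (jac F t) *v h)) (at t)"
proof -
  have "((\<lambda>s. F s $ j) has_derivative (\<lambda>h. (transpose (jac F t) *v h) $ j)) (at t)" for j
    unfolding transpose_jac_mult_vector
    using F by (intro has_derivative_grad) (simp add: twice_differentiable_def)
  then show ?thesis
    by (subst has_derivative_componentwise_within) (auto simp: Basis_vec_def inner_axis)
qed

lemma has_derivative_grad_compose:
  fixes F :: "real^'n \<Rightarrow> real^'m"
  assumes L: "twice_differentiable L" and F: "\<And>j. twice_differentiable (\<lambda>t. F t $ j)"
  shows "((\<lambda>t. grad L (F t)) has_derivative (\<lambda>h. hess L (F t) *v (transpose (jac F t) *v h))) (at t)"
  by (rule has_derivative_compose[OF has_derivative_jac[OF F] has_derivative_grad_hess[OF L]])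

lemma has_derivative_compose_grad:
  fixes F :: "real^'n \<Rightarrow> real^'m"
  assumes L: "twice_differentiable L" and F: "\<And>j. twice_differentiable (\<lambda>t. F t $ j)"
  shows "((\<lambda>t. L (F t)) has_derivative (\<lambda>h. (jac F t *v grad L (F t)) \<bullet> h)) (at t)"
proof -
  have "((\<lambda>t. L (F t)) has_derivative (\<lambda>h. grad L (F t) \<bullet> (transpose (jac F t) *v h))) (at t)"
    using L by (intro has_derivative_compose[OF has_derivative_jac[OF F] has_derivative_grad])
      (simp add: twice_differentiable_def)
  then show ?thesis
    by (simp only: transpose_mult_inner)
qed

text \<open>Product rule for the sum over the outputs: differentiating the loss gradient gives the
  Gauss-Newton part, differentiating the gradients of the outputs gives the residual part.\<close>

lemma has_derivative_jac_grad:
  fixes F :: "real^'n \<Rightarrow> real^'m"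
  assumes L: "twice_differentiable L" and F: "\<And>j. twice_differentiable (\<lambda>t. F t $ j)"
  shows "((\<lambda>t. jac F t *v grad L (F t)) has_derivative (\<lambda>h. (gn_part F L t + res_part F L t) *v h)) (at t)"
proof -
  define p where "p t = grad L (F t)" for t
  define Dp where "Dp h = hess L (F t) *v (transpose (jac F t) *v h)" for h
  have p: "((\<lambda>t. p t $ j) has_derivative (\<lambda>h. Dp h $ j)) (at t)" for j
    unfolding p_def Dp_def
    by (rule bounded_linear.has_derivative[OF bounded_linear_vec_nth has_derivative_grad_compose[OF L F]])
  have "((\<lambda>t. \<Sum>j\<in>UNIV. p t $ j *\<^sub>R grad (\<lambda>s. F s $ j) t) has_derivative
      (\<lambda>h. \<Sum>j\<in>UNIV. p t $ j *\<^sub>R (hess (\<lambda>s. F s $ j) t *v h) + Dp h $ j *\<^sub>R grad (\<lambda>s. F s $ j) t)) (at t)"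
    by (intro has_derivative_sum has_derivative_scaleR p has_derivative_grad_hess F)
  moreover have "(\<Sum>j\<in>UNIV. p t $ j *\<^sub>R (hess (\<lambda>s. F s $ j) t *v h) + Dp h $ j *\<^sub>R grad (\<lambda>s. F s $ j) t)
      = (gn_part F L t + res_part F L t) *v h" for h
  proof -
    have "(\<Sum>j\<in>UNIV. Dp h $ j *\<^sub>R grad (\<lambda>s. F s $ j) t) = gn_part F L t *v h"
      by (simp add: gn_part_def Dp_def flip: jac_mult_vector matrix_vector_mul_assoc del: transpose_matrix_vector)
    moreover have "(\<Sum>j\<in>UNIV. p t $ j *\<^sub>R (hess (\<lambda>s. F s $ j) t *v h)) = res_part F L t *v h"
      by (simp add: res_part_mult_vector p_def)
    ultimately show ?thesis
      by (simp add: sum.distrib matrix_vector_mult_add_rdistrib)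
  qed
  ultimately show ?thesis by (simp add: jac_mult_vector p_def)
qed

section \<open>Lipschitz estimates and quadratic remainders relative to a point\<close>

definition lipschitz_at :: "('a::real_normed_vector \<Rightarrow> 'b::real_normed_vector) \<Rightarrow> 'a \<Rightarrow> bool" where
  "lipschitz_at F x \<longleftrightarrow> (\<exists>C\<ge>0. \<forall>\<^sub>F t in nhds x. norm (F t - F x) \<le> C * norm (t - x))"

lemma lipschitz_atI:
  assumes "\<forall>\<^sub>F t in nhds x. norm (F t - F x) \<le> C * norm (t - x)"
  shows "lipschitz_at F x"
proof -
  have "\<forall>\<^sub>F t in nhds x. norm (F t - F x) \<le> \<bar>C\<bar> * norm (t - x)"
    using assms by eventually_elim (meson abs_ge_self mult_right_mono norm_ge_zero order_trans)
  then show ?thesis unfolding lipschitz_at_def by (intro exI[of _ "\<bar>C\<bar>"]) simp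
qed

lemma lipschitz_at_const: "lipschitz_at (\<lambda>t. c) x"
  by (rule lipschitz_atI[where C = 0]) simp

lemma lipschitz_at_add:
  assumes "lipschitz_at F x" "lipschitz_at G x"
  shows "lipschitz_at (\<lambda>t. F t + G t) x"
proof -
  from assms obtain C1 C2 where
    "\<forall>\<^sub>F t in nhds x. norm (F t - F x) \<le> C1 * norm (t - x)"
    "\<forall>\<^sub>F t in nhds x. norm (G t - G x) \<le> C2 * norm (t - x)"
    unfolding lipschitz_at_def by blast
  then have "\<forall>\<^sub>F t in nhds x. norm ((F t + G t) - (F x + G x)) \<le> (C1 + C2) * norm (t - x)"
    by eventually_elim (simp add: add_diff_add distrib_right norm_triangle_mono)
  then show ?thesis by (rule lipschitz_atI)
qed

lemma lipschitz_at_sum: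
  "(\<And>i. i \<in> S \<Longrightarrow> lipschitz_at (F i) x) \<Longrightarrow> lipschitz_at (\<lambda>t. \<Sum>i\<in>S. F i t) x"
  by (induction S rule: infinite_finite_induct) (auto intro: lipschitz_at_const lipschitz_at_add)

lemma lipschitz_at_bounded_linear:
  assumes "bounded_linear f" "lipschitz_at F x"
  shows "lipschitz_at (\<lambda>t. f (F t)) x"
proof -
  interpret bounded_linear f by fact
  obtain B where B: "\<And>y. norm (f y) \<le> norm y * B" "0 < B" using pos_bounded by blast
  obtain C where "\<forall>\<^sub>F t in nhds x. norm (F t - F x) \<le> C * norm (t - x)"
    using assms(2) unfolding lipschitz_at_def by blast
  then have "\<forall>\<^sub>F t in nhds x. norm (f (F t) - f (F x)) \<le> (C * B) * norm (t - x)"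
  proof eventually_elim
    case (elim t)
    have "norm (f (F t) - f (F x)) \<le> norm (F t - F x) * B" using B(1)[of "F t - F x"] by (simp add: diff)
    also have "\<dots> \<le> (C * norm (t - x)) * B" using elim B(2) by (intro mult_right_mono) auto
    finally show ?case by (simp add: mult_ac)
  qed
  then show ?thesis by (rule lipschitz_atI)
qed

lemma lipschitz_at_bounded_bilinear:
  assumes "bounded_bilinear pr" "lipschitz_at F x" "lipschitz_at G x"
  shows "lipschitz_at (\<lambda>t. pr (F t) (G t)) x"
proof -
  interpret bounded_bilinear pr by fact
  obtain B where B: "\<And>a b. norm (pr a b) \<le> norm a * norm b * B" "0 < B" using pos_bounded by blast
  obtain C1 C2 where C: "0 \<le> C1" "0 \<le> C2"
    and ev: "\<forall>\<^sub>F t in nhds x. norm (F t - F x) \<le> C1 * norm (t - x)"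
      "\<forall>\<^sub>F t in nhds x. norm (G t - G x) \<le> C2 * norm (t - x)"
    using assms(2,3) unfolding lipschitz_at_def by blast
  \<comment> \<open>Radius one is arbitrary; it only keeps the second factor bounded near
    \<open>x\<close>.\<close>
  have "\<forall>\<^sub>F t in nhds x. t \<in> ball x 1" by (intro eventually_nhds_in_open) auto
  with ev have "\<forall>\<^sub>F t in nhds x. norm (pr (F t) (G t) - pr (F x) (G x))
      \<le> ((C1 * (norm (G x) + C2) + norm (F x) * C2) * B) * norm (t - x)"
  proof eventually_elim
    case (elim t)
    have G: "norm (G t) \<le> norm (G x) + C2"
    proof -
      have "C2 * norm (t - x) \<le> C2 * 1"
        using elim(3) C by (intro mult_left_mono) (auto simp: dist_norm norm_minus_commute)
      then show ?thesis using elim(2) norm_triangle_sub[of "G t" "G x"] by linarith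
    qed
    have "pr (F t) (G t) - pr (F x) (G x) = pr (F t - F x) (G t) + pr (F x) (G t - G x)"
      by (simp add: diff_left diff_right)
    also have "norm \<dots> \<le> norm (F t - F x) * norm (G t) * B + norm (F x) * norm (G t - G x) * B"
      by (intro norm_triangle_mono B(1))
    also have "\<dots> \<le> (C1 * norm (t - x)) * (norm (G x) + C2) * B + norm (F x) * (C2 * norm (t - x)) * B"
      using elim G B(2) C by (intro add_mono mult_right_mono mult_left_mono mult_mono) auto
    finally show ?case by (simp add: algebra_simps)
  qed
  then show ?thesis by (rule lipschitz_atI)
qed

lemma lipschitz_at_differentiable:
  assumes "F differentiable (at x)"
  shows "lipschitz_at F x"
proof -
  obtain D where D: "(F has_derivative D) (at x)" using assms by (auto simp: differentiable_def)
  obtain B where B: "\<And>h. norm (D h) \<le> norm h * B"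
    using bounded_linear.pos_bounded[OF has_derivative_bounded_linear[OF D]] by blast
  obtain d where d: "0 < d" "\<And>y. norm (y - x) < d \<Longrightarrow> norm (F y - F x - D (y - x)) \<le> 1 * norm (y - x)"
    using D zero_less_one unfolding has_derivative_at_alt by blast
  have "norm (F t - F x) \<le> (1 + B) * norm (t - x)" if "t \<in> ball x d" for t
  proof -
    have "norm (F t - F x) \<le> norm (F t - F x - D (t - x)) + norm (D (t - x))"
      using norm_triangle_sub[of "F t - F x" "D (t - x)"] by simp
    also have "\<dots> \<le> 1 * norm (t - x) + norm (t - x) * B"
      using that by (intro add_mono d(2) B) (simp add: dist_norm norm_minus_commute)
    finally show ?thesis by (simp add: algebra_simps)
  qed
  moreover have "\<forall>\<^sub>F t in nhds x. t \<in> ball x d" using d(1) by (intro eventually_nhds_in_open) auto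
  ultimately show ?thesis
    by (intro lipschitz_atI[where C = "1 + B"]) (auto elim: eventually_mono)
qed

lemma lipschitz_at_vec:
  fixes F :: "'a::real_normed_vector \<Rightarrow> 'b::real_normed_vector^'n"
  assumes "\<And>i. lipschitz_at (\<lambda>t. F t $ i) x"
  shows "lipschitz_at F x"
proof -
  from assms obtain C where "\<And>i. \<forall>\<^sub>F t in nhds x. norm (F t $ i - F x $ i) \<le> C i * norm (t - x)"
    unfolding lipschitz_at_def by metis
  then have "\<forall>\<^sub>F t in nhds x. \<forall>i. norm (F t $ i - F x $ i) \<le> C i * norm (t - x)"
    by (simp add: eventually_all_finite)
  then have "\<forall>\<^sub>F t in nhds x. norm (F t - F x) \<le> (\<Sum>i\<in>UNIV. C i) * norm (t - x)"
  proof eventually_elim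
    case (elim t)
    have "norm (F t - F x) \<le> (\<Sum>i\<in>UNIV. norm ((F t - F x) $ i))"
      unfolding norm_vec_def by (rule L2_set_le_sum) simp
    also have "\<dots> \<le> (\<Sum>i\<in>UNIV. C i * norm (t - x))" using elim by (intro sum_mono) simp
    finally show ?case by (simp add: sum_distrib_right)
  qed
  then show ?thesis by (rule lipschitz_atI)
qed

lemma bounded_bilinear_matrix_mult:
  "bounded_bilinear ((**) :: real^'n^'m \<Rightarrow> real^'k^'n \<Rightarrow> real^'k^'m)"
proof
  show "\<exists>K. \<forall>A B. norm ((A :: real^'n^'m) ** (B :: real^'k^'n)) \<le> norm A * norm B * K"
    by (intro exI[of _ 1]) (simp add: norm_matrix_matrix_mult_le)
qed (simp_all add: matrix_add_ldistrib matrix_add_rdistrib matrix_scalar_ac flip: scalar_matrix_assoc)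

lemma bounded_linear_transpose: "bounded_linear (transpose :: real^'n^'m \<Rightarrow> real^'m^'n)"
  by (rule bounded_linear_intro[where K = 1])
    (simp_all add: transpose_add transpose_scaleR norm_transpose)

lemma lipschitz_at_jac:
  assumes F: "\<And>j. twice_differentiable (\<lambda>t. F t $ j)"
  shows "lipschitz_at (jac F) x"
proof -
  have "lipschitz_at (\<lambda>t. transpose (jac F t)) x"
  proof (rule lipschitz_at_vec)
    fix j
    have "transpose (jac F t) $ j = grad (\<lambda>s. F s $ j) t" for t
      by (simp add: transpose_def jac_def vec_eq_iff)
    then show "lipschitz_at (\<lambda>t. transpose (jac F t) $ j) x"
      using F by (simp add: lipschitz_at_differentiable twice_differentiable_def)
  qed
  from lipschitz_at_bounded_linear[OF bounded_linear_transpose this] show ?thesis by simp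
qed

lemma lipschitz_at_gn_part:
  assumes F: "\<And>j. twice_differentiable (\<lambda>t. F t $ j)" and H: "lipschitz_at (\<lambda>t. hess L (F t)) x"
  shows "lipschitz_at (gn_part F L) x"
  unfolding gn_part_def[abs_def]
  by (intro lipschitz_at_bounded_bilinear[OF bounded_bilinear_matrix_mult] H lipschitz_at_jac F
      lipschitz_at_bounded_linear[OF bounded_linear_transpose])

lemma lipschitz_at_grad_compose:
  assumes "twice_differentiable L" "\<And>j. twice_differentiable (\<lambda>t. F t $ j)"
  shows "lipschitz_at (\<lambda>t. grad L (F t)) x"
  using has_derivative_grad_compose[OF assms] by (intro lipschitz_at_differentiable) (auto simp: differentiable_def)

lemma lipschitz_at_res_part:
  assumes L: "twice_differentiable L" and F: "\<And>j. twice_differentiable (\<lambda>t. F t $ j)"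
    and H: "\<And>j. lipschitz_at (hess (\<lambda>s. F s $ j)) x"
  shows "lipschitz_at (res_part F L) x"
  unfolding res_part_def[abs_def]
  by (intro lipschitz_at_sum lipschitz_at_bounded_bilinear[OF bounded_bilinear_scaleR] H
      lipschitz_at_bounded_linear[OF bounded_linear_vec_nth] lipschitz_at_grad_compose L F)

text \<open>The remainder of a difference linearized at the fixed centre \<open>x\<close> rather
  than at one of its arguments. Along iterates with summable errors the factor
  \<open>norm (y - x) + norm (z - x)\<close> becomes the summable relative error
  \<open>\<sigma>\<close>.\<close>

definition quadratic_remainder_at ::
  "('a::real_normed_vector \<Rightarrow> 'a \<Rightarrow> 'b::real_normed_vector) \<Rightarrow> 'a \<Rightarrow> bool" where
  "quadratic_remainder_at R x \<longleftrightarrow> (\<exists>C\<ge>0. \<exists>r>0. \<forall>y\<in>ball x r. \<forall>z\<in>ball x r.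
     norm (R y z) \<le> C * (norm (y - x) + norm (z - x)) * norm (y - z))"

lemma quadratic_remainder_at_zero: "quadratic_remainder_at (\<lambda>y z. 0) x"
  unfolding quadratic_remainder_at_def by (intro exI[of _ 0] conjI exI[of _ 1]) auto

lemma quadratic_remainder_at_add:
  assumes "quadratic_remainder_at R x" "quadratic_remainder_at Q x"
  shows "quadratic_remainder_at (\<lambda>y z. R y z + Q y z) x"
proof -
  obtain C1 r1 where 1: "0 \<le> C1" "0 < r1"
    "\<And>y z. y \<in> ball x r1 \<Longrightarrow> z \<in> ball x r1 \<Longrightarrow> norm (R y z) \<le> C1 * (norm (y - x) + norm (z - x)) * norm (y - z)"
    using assms(1) unfolding quadratic_remainder_at_def by blast
  obtain C2 r2 where 2: "0 \<le> C2" "0 < r2"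
    "\<And>y z. y \<in> ball x r2 \<Longrightarrow> z \<in> ball x r2 \<Longrightarrow> norm (Q y z) \<le> C2 * (norm (y - x) + norm (z - x)) * norm (y - z)"
    using assms(2) unfolding quadratic_remainder_at_def by blast
  have "norm (R y z + Q y z) \<le> (C1 + C2) * (norm (y - x) + norm (z - x)) * norm (y - z)"
    if "y \<in> ball x (min r1 r2)" "z \<in> ball x (min r1 r2)" for y z
    using norm_triangle_mono[OF 1(3)[of y z] 2(3)[of y z]] that by (simp add: algebra_simps)
  then show ?thesis
    unfolding quadratic_remainder_at_def using 1(1,2) 2(1,2)
    by (intro exI[of _ "C1 + C2"] conjI exI[of _ "min r1 r2"]) auto
qed

lemma quadratic_remainder_at_sum:
  "(\<And>i. i \<in> S \<Longrightarrow> quadratic_remainder_at (R i) x) \<Longrightarrow> quadratic_remainder_at (\<lambda>y z. \<Sum>i\<in>S. R i y z) x"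
  by (induction S rule: infinite_finite_induct)
    (auto intro: quadratic_remainder_at_zero quadratic_remainder_at_add)

lemma quadratic_remainder_at_scaleR:
  assumes "quadratic_remainder_at R x"
  shows "quadratic_remainder_at (\<lambda>y z. c *\<^sub>R R y z) x"
proof -
  obtain C r where C: "0 \<le> C" "0 < r"
    "\<And>y z. y \<in> ball x r \<Longrightarrow> z \<in> ball x r \<Longrightarrow> norm (R y z) \<le> C * (norm (y - x) + norm (z - x)) * norm (y - z)"
    using assms unfolding quadratic_remainder_at_def by blast
  have "norm (c *\<^sub>R R y z) \<le> (\<bar>c\<bar> * C) * (norm (y - x) + norm (z - x)) * norm (y - z)"
    if "y \<in> ball x r" "z \<in> ball x r" for y z
    using mult_left_mono[OF C(3)[OF that], of "\<bar>c\<bar>"] by (simp add: mult.assoc)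
  then show ?thesis
    unfolding quadratic_remainder_at_def using C(1,2)
    by (intro exI[of _ "\<bar>c\<bar> * C"] conjI exI[of _ r]) auto
qed

text \<open>The mean value inequality is applied to \<open>F\<close> minus its linearization. On the
  closed ball about \<open>x\<close> through the farther of the two points, the derivative of this
  map is at most \<open>C\<close> times the radius.\<close>

lemma quadratic_remainder_at_derivative:
  fixes F :: "real^'n \<Rightarrow> real^'m"
  assumes D: "\<And>t. (F has_derivative (\<lambda>h. A t *v h)) (at t)" and A: "lipschitz_at A x"
  shows "quadratic_remainder_at (\<lambda>y z. F y - F z - A x *v (y - z)) x"
proof -
  obtain C where C: "0 \<le> C" "\<forall>\<^sub>F t in nhds x. norm (A t - A x) \<le> C * norm (t - x)"
    using A unfolding lipschitz_at_def by blast
  then obtain r where r: "0 < r" "\<And>t. dist t x < r \<Longrightarrow> norm (A t - A x) \<le> C * norm (t - x)"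
    unfolding eventually_nhds_metric by blast
  have "norm (F y - F z - A x *v (y - z)) \<le> C * (norm (y - x) + norm (z - x)) * norm (y - z)"
    if yz: "y \<in> ball x r" "z \<in> ball x r" for y z
  proof -
    define \<rho> where "\<rho> = max (norm (y - x)) (norm (z - x))"
    have "\<rho> < r" using yz by (simp add: \<rho>_def dist_norm norm_minus_commute)
    have "norm ((F y - A x *v y) - (F z - A x *v z)) \<le> (C * \<rho>) * norm (y - z)"
    proof (rule differentiable_bound[where S = "cball x \<rho>" and f = "\<lambda>t. F t - A x *v t" and f' = "\<lambda>t h. (A t - A x) *v h"])
      show "((\<lambda>t. F t - A x *v t) has_derivative (\<lambda>h. (A t - A x) *v h)) (at t within cball x \<rho>)" for t
        unfolding matrix_vector_mult_diff_rdistrib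
        by (intro has_derivative_diff has_derivative_at_withinI[OF D]
            bounded_linear_imp_has_derivative matrix_vector_mul_bounded_linear)
      show "onorm (\<lambda>h. (A t - A x) *v h) \<le> C * \<rho>" if "t \<in> cball x \<rho>" for t
      proof (rule onorm_le)
        fix h
        have "norm (A t - A x) \<le> C * norm (t - x)"
          using that \<open>\<rho> < r\<close> by (intro r(2)) (simp add: dist_commute)
        also have "\<dots> \<le> C * \<rho>"
          using that C(1) by (intro mult_left_mono) (auto simp: dist_norm norm_minus_commute)
        finally show "norm ((A t - A x) *v h) \<le> C * \<rho> * norm h"
          by (intro order_trans[OF norm_matrix_vector_mult_le] mult_right_mono) auto
      qed
    qed (auto simp: \<rho>_def dist_norm norm_minus_commute)
    moreover have "C * \<rho> * norm (y - z) \<le> C * (norm (y - x) + norm (z - x)) * norm (y - z)"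
      using C(1) by (intro mult_right_mono mult_left_mono) (auto simp: \<rho>_def)
    moreover have "(F y - A x *v y) - (F z - A x *v z) = F y - F z - A x *v (y - z)"
      by (simp add: matrix_vector_mult_diff_distrib)
    ultimately show ?thesis by simp
  qed
  then show ?thesis unfolding quadratic_remainder_at_def using C(1) r(1) by blast
qed

lemma quadratic_remainder_at_lipschitz_factor:
  fixes q :: "real^'n \<Rightarrow> real^'m" and p :: "real^'n \<Rightarrow> real"
  assumes p: "lipschitz_at p x" and q: "quadratic_remainder_at (\<lambda>y z. q y - q z - A *v (y - z)) x"
  shows "quadratic_remainder_at (\<lambda>y z. p y *\<^sub>R (q y - q z) - p x *\<^sub>R (A *v (y - z))) x"
proof -
  obtain C1 where C1: "0 \<le> C1" "\<forall>\<^sub>F t in nhds x. norm (p t - p x) \<le> C1 * norm (t - x)"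
    using p unfolding lipschitz_at_def by blast
  then obtain r1 where r1: "0 < r1" "\<And>t. dist t x < r1 \<Longrightarrow> norm (p t - p x) \<le> C1 * norm (t - x)"
    unfolding eventually_nhds_metric by blast
  obtain C2 r2 where 2: "0 \<le> C2" "0 < r2"
    "\<And>y z. y \<in> ball x r2 \<Longrightarrow> z \<in> ball x r2 \<Longrightarrow> norm (q y - q z - A *v (y - z)) \<le> C2 * (norm (y - x) + norm (z - x)) * norm (y - z)"
    using q unfolding quadratic_remainder_at_def by blast
  define r where "r = min 1 (min r1 r2)"
  define C where "C = (norm (p x) + C1) * C2 + C1 * norm A"
  have "norm (p y *\<^sub>R (q y - q z) - p x *\<^sub>R (A *v (y - z))) \<le> C * (norm (y - x) + norm (z - x)) * norm (y - z)"
    if yz: "y \<in> ball x r" "z \<in> ball x r" for y z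
  proof -
    define \<rho> where "\<rho> = norm (y - x) + norm (z - x)"
    have y1: "norm (y - x) \<le> 1" using yz by (simp add: r_def dist_norm norm_minus_commute)
    have py: "norm (p y - p x) \<le> C1 * norm (y - x)"
      using yz by (intro r1(2)) (simp add: r_def dist_commute)
    then have py': "norm (p y) \<le> norm (p x) + C1"
      using norm_triangle_sub[of "p y" "p x"] mult_left_mono[OF y1 C1(1)] by linarith
    have py2: "norm (p y - p x) \<le> C1 * \<rho>"
      using C1(1) by (intro order_trans[OF py] mult_left_mono) (simp_all add: \<rho>_def)
    have "p y *\<^sub>R (q y - q z) - p x *\<^sub>R (A *v (y - z))
        = p y *\<^sub>R (q y - q z - A *v (y - z)) + (p y - p x) *\<^sub>R (A *v (y - z))"
      by (simp add: algebra_simps)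
    also have "norm \<dots> \<le> norm (p y) * norm (q y - q z - A *v (y - z)) + norm (p y - p x) * norm (A *v (y - z))"
      by (intro norm_triangle_le add_mono) simp_all
    also have "\<dots> \<le> (norm (p x) + C1) * (C2 * \<rho> * norm (y - z)) + (C1 * \<rho>) * (norm A * norm (y - z))"
      using yz 2(1,3) py' py2 C1(1) unfolding \<rho>_def
      by (intro add_mono mult_mono norm_matrix_vector_mult_le) (auto simp: r_def)
    also have "\<dots> = C * \<rho> * norm (y - z)" by (simp add: C_def algebra_simps)
    finally show ?thesis by (simp add: \<rho>_def)
  qed
  moreover have "0 \<le> C" "0 < r" using C1(1) 2 r1(1) by (auto simp: C_def r_def)
  ultimately show ?thesis unfolding quadratic_remainder_at_def by blast
qed

text \<open>Summed over the outputs, each term of the secant vector is a loss derivative at the new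
  point times a difference of output gradients. Freezing the first factor and linearizing the second
  at \<open>x\<close> produces the residual part there.\<close>

lemma quadratic_remainder_at_secant:
  fixes F :: "real^'n \<Rightarrow> real^'m"
  assumes L: "twice_differentiable L" and F: "\<And>j. twice_differentiable (\<lambda>t. F t $ j)"
    and H: "\<And>j. lipschitz_at (hess (\<lambda>s. F s $ j)) x"
  shows "quadratic_remainder_at
     (\<lambda>y z. (jac F y - jac F z) *v grad L (F y) - res_part F L x *v (y - z)) x"
proof -
  define p where "p t = grad L (F t)" for t
  define q where "q j = grad (\<lambda>s. F s $ j)" for j
  have "(jac F y - jac F z) *v grad L (F y) - res_part F L x *v h
     = (\<Sum>j\<in>UNIV. p y $ j *\<^sub>R (q j y - q j z) - p x $ j *\<^sub>R (hess (\<lambda>s. F s $ j) x *v h))" for y z h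
    by (simp add: matrix_vector_mult_diff_rdistrib jac_mult_vector res_part_mult_vector p_def q_def
        scaleR_diff_right sum_subtractf)
  moreover have "quadratic_remainder_at
     (\<lambda>y z. \<Sum>j\<in>UNIV. p y $ j *\<^sub>R (q j y - q j z) - p x $ j *\<^sub>R (hess (\<lambda>s. F s $ j) x *v (y - z))) x"
    unfolding p_def q_def
    by (intro quadratic_remainder_at_sum quadratic_remainder_at_lipschitz_factor
        quadratic_remainder_at_derivative has_derivative_grad_hess F H
        lipschitz_at_bounded_linear[OF bounded_linear_vec_nth] lipschitz_at_grad_compose L)
  ultimately show ?thesis by simp
qed

section \<open>The averaged objective and the iteration along one sample path\<close>

lemma transpose_res_part:
  assumes "\<And>j. twice_differentiable (\<lambda>t. F t $ j)"
  shows "transpose (res_part F L x) = res_part F L x"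
  unfolding res_part_def linear_sum[OF bounded_linear.linear[OF bounded_linear_transpose]]
  by (simp add: transpose_scaleR transpose_hess assms)

lemma has_derivative_objective:
  fixes f :: "nat \<Rightarrow> real^'n \<Rightarrow> real^'m"
  assumes smooth: "\<And>i. i \<in> {1..N} \<Longrightarrow> twice_differentiable (sloss ell y i)"
      "\<And>i j. i \<in> {1..N} \<Longrightarrow> twice_differentiable (\<lambda>t. f i t $ j)"
  defines "A \<equiv> \<lambda>t. (1 / real N) *\<^sub>R (\<Sum>i\<in>{1..N}. gn_part (f i) (sloss ell y i) t + res_part (f i) (sloss ell y i) t)"
  shows "(objective N f ell y has_derivative (\<lambda>h. grad (objective N f ell y) t \<bullet> h)) (at t)"
    and "(grad (objective N f ell y) has_derivative (\<lambda>h. A t *v h)) (at t)"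
proof -
  let ?c = "1 / real N"
  let ?g = "\<lambda>t. ?c *\<^sub>R (\<Sum>i\<in>{1..N}. jac (f i) t *v grad (sloss ell y i) (f i t))"
  have D: "(objective N f ell y has_derivative (\<lambda>h. ?g t \<bullet> h)) (at t)" for t
  proof -
    have "((\<lambda>t. ?c * (\<Sum>i\<in>{1..N}. sloss ell y i (f i t))) has_derivative
        (\<lambda>h. ?c * (\<Sum>i\<in>{1..N}. (jac (f i) t *v grad (sloss ell y i) (f i t)) \<bullet> h))) (at t)"
      by (intro has_derivative_mult_right has_derivative_sum has_derivative_compose_grad smooth)
    then show ?thesis
      by (simp add: objective_def[abs_def] sloss_def inner_sum_left)
  qed
  have g: "grad (objective N f ell y) = ?g"
    by (rule ext) (rule grad_eqI[OF D])
  show "(objective N f ell y has_derivative (\<lambda>h. grad (objective N f ell y) t \<bullet> h)) (at t)"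
    unfolding g by (rule D)
  have "(?g has_derivative (\<lambda>h. ?c *\<^sub>R (\<Sum>i\<in>{1..N}. (gn_part (f i) (sloss ell y i) t
      + res_part (f i) (sloss ell y i) t) *v h))) (at t)"
    by (intro has_derivative_scaleR_right has_derivative_sum has_derivative_jac_grad smooth)
  then show "(grad (objective N f ell y) has_derivative (\<lambda>h. A t *v h)) (at t)"
    unfolding g A_def by (simp only: sum_matrix_vector_mult flip: scaleR_matrix_vector_assoc)
qed

text \<open>The iteration is an instance of \<open>bfgs_superlinear\<close> with \<open>P\<close>
  the averaged residual part at the optimum. As \<open>A \<theta>s\<close> is
  \<open>H \<theta>s + P\<close>, the matrix \<open>G - P\<close> there is the full Gauss-Newton
  part at the optimum, which the sampled matrix approximates once the samples are complete.\<close>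

lemma bfgs_gauss_newton_superlinear:
  fixes f :: "nat \<Rightarrow> real^'n \<Rightarrow> real^'m" and ell :: "real^'m \<Rightarrow> 'y \<Rightarrow> real" and y :: "nat \<Rightarrow> 'y"
    and \<theta>s :: "real^'n" and \<theta> :: "nat \<Rightarrow> real^'n" and \<Lambda> :: "nat \<Rightarrow> real^'n^'n" and S :: "nat \<Rightarrow> nat set"
  defines "u \<equiv> \<lambda>k. \<theta> (Suc k) - \<theta> k"
  defines "v \<equiv> \<lambda>k. secant_v (S k) f ell y (\<theta> k) (\<theta> (Suc k))"
  assumes N: "1 \<le> N"
    and smooth: "\<And>i. i \<in> {1..N} \<Longrightarrow> twice_differentiable (sloss ell y i)"
      "\<And>i j. i \<in> {1..N} \<Longrightarrow> twice_differentiable (\<lambda>t. f i t $ j)"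
    and full: "\<forall>\<^sub>F k in sequentially. S k = {1..N}"
    and iter: "\<And>k. invertible (sub_ggn (S k) f ell y (\<theta> k) + \<Lambda> k)"
      "\<And>k. \<theta> (Suc k) = \<theta> k - matrix_inv (sub_ggn (S k) f ell y (\<theta> k) + \<Lambda> k) *v grad (objective N f ell y) (\<theta> k)"
    and \<Lambda>0: "transpose (\<Lambda> 0) = \<Lambda> 0" "pos_def (\<Lambda> 0)"
    and bfgs: "\<And>k. \<Lambda> (Suc k) = \<Lambda> k - (1 / (u k \<bullet> (\<Lambda> k *v u k))) *\<^sub>R outer (\<Lambda> k *v u k) (u k v* \<Lambda> k)
                          + (1 / (u k \<bullet> v k)) *\<^sub>R outer (v k) (v k)"
    and nz: "\<And>k. u k \<bullet> (\<Lambda> k *v u k) \<noteq> 0" "\<And>k. u k \<bullet> v k \<noteq> 0"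
    and optimal: "\<And>t. objective N f ell y \<theta>s \<le> objective N f ell y t"
    and hess_pd: "pos_def (hess (objective N f ell y) \<theta>s)"
    and lam: "0 < lam" "\<And>i. i \<in> {1..N} \<Longrightarrow> loewner_ge (res_part (f i) (sloss ell y i) \<theta>s) (lam *\<^sub>R mat 1)"
    and summable: "summable (\<lambda>k. norm (\<theta> k - \<theta>s))"
    and HL: "\<And>i. i \<in> {1..N} \<Longrightarrow> lipschitz_at (\<lambda>t. hess (sloss ell y i) (f i t)) \<theta>s"
    and Hf: "\<And>i j. i \<in> {1..N} \<Longrightarrow> lipschitz_at (hess (\<lambda>z. f i z $ j)) \<theta>s"
    and \<delta>: "0 < \<delta>"
  shows "\<exists>K. \<forall>k\<ge>K. norm (\<theta> (Suc k) - \<theta>s) \<le> \<delta> * norm (\<theta> k - \<theta>s)"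
proof -
  define \<Psi> where "\<Psi> = objective N f ell y"
  define c where "c = 1 / real N"
  have c0: "0 < c" using N by (simp add: c_def)
  define A where "A t = c *\<^sub>R (\<Sum>i\<in>{1..N}. gn_part (f i) (sloss ell y i) t + res_part (f i) (sloss ell y i) t)" for t
  define P where "P = c *\<^sub>R (\<Sum>i\<in>{1..N}. res_part (f i) (sloss ell y i) \<theta>s)"
  define H where "H = sub_ggn {1..N} f ell y"
  have H_eq: "H t = c *\<^sub>R (\<Sum>i\<in>{1..N}. gn_part (f i) (sloss ell y i) t)" for t
    by (simp add: H_def sub_ggn_def c_def)
  have D1: "(\<Psi> has_derivative (\<lambda>h. grad \<Psi> t \<bullet> h)) (at t)" for t
    unfolding \<Psi>_def by (rule has_derivative_objective(1)[OF smooth])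
  have D2: "(grad \<Psi> has_derivative (\<lambda>h. A t *v h)) (at t)" for t
    unfolding \<Psi>_def A_def[abs_def] c_def by (rule has_derivative_objective(2)[OF smooth])
  have "twice_differentiable \<Psi>"
    using D1 D2 unfolding twice_differentiable_def differentiable_def by blast
  then have symG: "transpose (hess \<Psi> \<theta>s) = hess \<Psi> \<theta>s" by (rule transpose_hess)
  then have G: "hess \<Psi> \<theta>s = A \<theta>s" using hess_eqI[OF D2, of \<theta>s] by (metis transpose_transpose)
  have AHP: "A \<theta>s = H \<theta>s + P"
    by (simp add: A_def H_eq P_def sum.distrib scaleR_add_right)
  have symP: "transpose P = P"
    unfolding P_def linear_scale[OF bounded_linear.linear[OF bounded_linear_transpose]]
      linear_sum[OF bounded_linear.linear[OF bounded_linear_transpose]]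
    by (simp add: transpose_res_part smooth)
  have pdP: "pos_def P"
    unfolding pos_def_def
  proof (intro allI impI)
    fix x :: "real^'n" assume x: "x \<noteq> 0"
    have "0 < c * (\<Sum>i\<in>{1..N}. lam * (x \<bullet> x))" using c0 lam(1) N x by simp
    also have "\<dots> \<le> c * (\<Sum>i\<in>{1..N}. x \<bullet> (res_part (f i) (sloss ell y i) \<theta>s *v x))"
    proof (intro mult_left_mono sum_mono)
      show "lam * (x \<bullet> x) \<le> x \<bullet> (res_part (f i) (sloss ell y i) \<theta>s *v x)" if "i \<in> {1..N}" for i
        using lam(2)[OF that] unfolding loewner_ge_def
        by (simp add: matrix_vector_mult_diff_rdistrib inner_diff_right flip: scaleR_matrix_vector_assoc)
    qed (use c0 in simp)
    also have "\<dots> = x \<bullet> (P *v x)"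
      by (simp add: P_def sum_matrix_vector_mult inner_sum_right flip: scaleR_matrix_vector_assoc)
    finally show "0 < x \<bullet> (P *v x)" .
  qed
  \<comment> \<open>Optimality removes the constant term from the expansion of the gradient about
    \<open>\<theta>s\<close>.\<close>
  have "(\<lambda>h. grad \<Psi> \<theta>s \<bullet> h) = (\<lambda>h. 0)"
    using D1 by (rule has_derivative_local_min) (simp add: \<Psi>_def optimal)
  then have grad0: "grad \<Psi> \<theta>s = 0"
    by (metis inner_eq_zero_iff)
  have "quadratic_remainder_at (\<lambda>y z. grad \<Psi> y - grad \<Psi> z - A \<theta>s *v (y - z)) \<theta>s"
    unfolding A_def[abs_def]
    by (intro quadratic_remainder_at_derivative[OF D2[unfolded A_def]] lipschitz_at_bounded_linear[OF bounded_linear_scaleR_right]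
        lipschitz_at_sum lipschitz_at_add lipschitz_at_gn_part lipschitz_at_res_part smooth HL Hf)
  then obtain C1 r1 where 1: "0 \<le> C1" "0 < r1" "\<And>y z. y \<in> ball \<theta>s r1 \<Longrightarrow> z \<in> ball \<theta>s r1 \<Longrightarrow>
      norm (grad \<Psi> y - grad \<Psi> z - A \<theta>s *v (y - z)) \<le> C1 * (norm (y - \<theta>s) + norm (z - \<theta>s)) * norm (y - z)"
    unfolding quadratic_remainder_at_def by blast
  have "quadratic_remainder_at (\<lambda>t1 t0. secant_v {1..N} f ell y t0 t1 - P *v (t1 - t0)) \<theta>s"
  proof -
    have "secant_v {1..N} f ell y t0 t1 - P *v (t1 - t0) = c *\<^sub>R (\<Sum>i\<in>{1..N}.
        (jac (f i) t1 - jac (f i) t0) *v grad (sloss ell y i) (f i t1) - res_part (f i) (sloss ell y i) \<theta>s *v (t1 - t0))" for t0 t1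
      by (simp add: secant_v_def P_def c_def sum_subtractf scaleR_diff_right sum_matrix_vector_mult
          flip: scaleR_matrix_vector_assoc)
    moreover have "quadratic_remainder_at (\<lambda>t1 t0. c *\<^sub>R (\<Sum>i\<in>{1..N}.
        (jac (f i) t1 - jac (f i) t0) *v grad (sloss ell y i) (f i t1) - res_part (f i) (sloss ell y i) \<theta>s *v (t1 - t0))) \<theta>s"
      by (intro quadratic_remainder_at_scaleR quadratic_remainder_at_sum quadratic_remainder_at_secant smooth Hf)
    ultimately show ?thesis by simp
  qed
  then obtain C2 r2 where 2: "0 \<le> C2" "0 < r2" "\<And>t1 t0. t1 \<in> ball \<theta>s r2 \<Longrightarrow> t0 \<in> ball \<theta>s r2 \<Longrightarrow>
      norm (secant_v {1..N} f ell y t0 t1 - P *v (t1 - t0)) \<le> C2 * (norm (t1 - \<theta>s) + norm (t0 - \<theta>s)) * norm (t1 - t0)"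
    unfolding quadratic_remainder_at_def by blast
  have "lipschitz_at H \<theta>s"
    unfolding H_eq[abs_def]
    by (intro lipschitz_at_bounded_linear[OF bounded_linear_scaleR_right] lipschitz_at_sum lipschitz_at_gn_part smooth HL)
  then obtain C3 where 3: "0 \<le> C3" "\<forall>\<^sub>F t in nhds \<theta>s. norm (H t - H \<theta>s) \<le> C3 * norm (t - \<theta>s)"
    unfolding lipschitz_at_def by blast
  define e where "e k = \<theta> k - \<theta>s" for k
  have e0: "e \<longlonglongrightarrow> 0"
    using summable_LIMSEQ_zero[OF summable] by (simp add: e_def[abs_def] tendsto_norm_zero_iff)
  then have lim: "\<theta> \<longlonglongrightarrow> \<theta>s"
    by (simp add: e_def[abs_def] LIM_zero_iff)
  have "\<forall>\<^sub>F k in sequentially. \<theta> k \<in> ball \<theta>s (min r1 r2)"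
    using lim by (rule topological_tendstoD) (use 1(2) 2(2) in auto)
  moreover have "\<forall>\<^sub>F k in sequentially. norm (H (\<theta> k) - H \<theta>s) \<le> C3 * norm (\<theta> k - \<theta>s)"
    using eventually_compose_filterlim[OF 3(2) lim] .
  ultimately have "\<forall>\<^sub>F k in sequentially. S k = {1..N} \<and> \<theta> k \<in> ball \<theta>s (min r1 r2) \<and>
      norm (H (\<theta> k) - H \<theta>s) \<le> C3 * norm (\<theta> k - \<theta>s)"
    using full by eventually_elim simp
  then obtain k0 where k0: "\<And>k. k0 \<le> k \<Longrightarrow> S k = {1..N}" "\<And>k. k0 \<le> k \<Longrightarrow> \<theta> k \<in> ball \<theta>s (min r1 r2)"
      "\<And>k. k0 \<le> k \<Longrightarrow> norm (H (\<theta> k) - H \<theta>s) \<le> C3 * norm (e k)"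
    unfolding eventually_sequentially e_def by blast
  define C where "C = C1 + C2 + C3"
  \<comment> \<open>The secant vector involves two consecutive iterates, hence two errors.
    Summability of \<open>\<sigma>\<close> is exactly where the assumed summability of the errors
    enters.\<close>
  define \<sigma> where "\<sigma> k = C * (norm (e k) + norm (e (Suc k)))" for k
  have C: "C1 \<le> C" "C2 \<le> C" "C3 \<le> C" "0 \<le> C" using 1(1) 2(1) 3(1) by (auto simp: C_def)
  \<comment> \<open>The assumed update contains the row product \<open>u k v* \<Lambda> k\<close>;
    symmetry identifies it with \<open>\<Lambda> k *v u k\<close>. Symmetry is in turn preserved by
    the update, so both facts come from one induction.\<close>
  have sym: "transpose (\<Lambda> k) = \<Lambda> k" and upd: "\<Lambda> (Suc k) = bfgs_update (\<Lambda> k) (u k) (v k)" for k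
  proof -
    have u: "\<Lambda> (Suc k) = bfgs_update (\<Lambda> k) (u k) (v k)" if "transpose (\<Lambda> k) = \<Lambda> k" for k
      using transpose_matrix_vector[of "\<Lambda> k" "u k"] that unfolding bfgs bfgs_update_def by simp
    show s: "transpose (\<Lambda> k) = \<Lambda> k" for k
      by (induction k) (simp_all add: \<Lambda>0 u transpose_bfgs_update)
    show "\<Lambda> (Suc k) = bfgs_update (\<Lambda> k) (u k) (v k)" by (rule u[OF s])
  qed
  have "\<exists>K. \<forall>k\<ge>K. norm (e (Suc k)) \<le> \<delta> * norm (e k)"
  proof (rule bfgs_superlinear[OF symG hess_pd[folded \<Psi>_def] symP pdP e0, where u = u and v = v and \<Lambda> = \<Lambda> and \<sigma> = \<sigma> and ?k0.0 = k0])
    show "u k = e (Suc k) - e k" for k by (simp add: u_def e_def)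
    show "transpose (\<Lambda> 0) = \<Lambda> 0" by (rule \<Lambda>0)
    show "invertible (\<Lambda> 0)" using \<Lambda>0(2) by (rule pos_def_invertible)
    show "0 \<le> \<sigma> k" for k using C by (simp add: \<sigma>_def)
    have "summable (\<lambda>k. norm (e k))" using summable by (simp add: e_def)
    then show "summable \<sigma>"
      unfolding \<sigma>_def[abs_def] by (intro summable_mult summable_add) (simp_all add: summable_Suc_iff[of "\<lambda>k. norm (e k)"])
  next
    fix k assume k: "k0 \<le> k"
    have "norm (v k - P *v u k) \<le> C2 * (norm (e (Suc k)) + norm (e k)) * norm (u k)"
      using 2(3)[of "\<theta> (Suc k)" "\<theta> k"] k0(2)[of k] k0(2)[of "Suc k"] k k0(1)[OF k]
      by (simp add: v_def u_def e_def)
    also have "\<dots> \<le> C * (norm (e (Suc k)) + norm (e k)) * norm (u k)"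
      using C by (intro mult_right_mono) auto
    finally show "norm (v k - P *v u k) \<le> \<sigma> k * norm (u k)" by (simp add: \<sigma>_def add.commute)
  next
    fix k assume k: "k0 \<le> k"
    have "(H (\<theta> k) + \<Lambda> k) *v u k = - grad \<Psi> (\<theta> k)"
    proof -
      have "u k = - (matrix_inv (H (\<theta> k) + \<Lambda> k) *v grad \<Psi> (\<theta> k))"
        using iter(2)[of k] k0(1)[OF k] by (simp add: u_def H_def \<Psi>_def)
      moreover have "invertible (H (\<theta> k) + \<Lambda> k)"
        using iter(1)[of k] k0(1)[OF k] by (simp add: H_def)
      ultimately show ?thesis
        by (simp add: matrix_vector_mult_minus matrix_vector_mul_assoc matrix_inv_inverse)
    qed
    \<comment> \<open>Inserting the iteration leaves two errors: the linearization of the gradient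
      at \<open>\<theta>s\<close>, and the change of the Gauss-Newton matrix from
      \<open>\<theta>s\<close> to \<open>\<theta> k\<close>.\<close>
    then have "hess \<Psi> \<theta>s *v e k + (hess \<Psi> \<theta>s - P + \<Lambda> k) *v u k
        = - (grad \<Psi> (\<theta> k) - grad \<Psi> \<theta>s - A \<theta>s *v (\<theta> k - \<theta>s)) - (H (\<theta> k) - H \<theta>s) *v u k"
      by (simp add: G AHP grad0 e_def matrix_vector_mult_add_rdistrib matrix_vector_mult_diff_rdistrib algebra_simps)
    also have "norm \<dots> \<le> C1 * (norm (e k) + 0) * norm (e k) + (C3 * norm (e k)) * norm (u k)"
    proof (intro norm_triangle_le_diff add_mono)
      show "norm (- (grad \<Psi> (\<theta> k) - grad \<Psi> \<theta>s - A \<theta>s *v (\<theta> k - \<theta>s))) \<le> C1 * (norm (e k) + 0) * norm (e k)"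
        using 1(2) 1(3)[of "\<theta> k" \<theta>s] k0(2)[OF k] by (simp only: norm_minus_cancel) (simp add: e_def)
      show "norm ((H (\<theta> k) - H \<theta>s) *v u k) \<le> C3 * norm (e k) * norm (u k)"
        by (intro order_trans[OF norm_matrix_vector_mult_le] mult_right_mono k0(3) k) simp
    qed
    also have "\<dots> \<le> \<sigma> k * norm (e k) + \<sigma> k * norm (u k)"
      unfolding \<sigma>_def using C by (intro add_mono mult_right_mono mult_mono) auto
    finally show "norm (hess \<Psi> \<theta>s *v e k + (hess \<Psi> \<theta>s - P + \<Lambda> k) *v u k) \<le> \<sigma> k * (norm (u k) + norm (e k))"
      by (simp add: algebra_simps)
  qed (use upd nz \<delta> in auto)
  then show ?thesis by (simp add: e_def)
qed

text \<open>Superlinear growth of the samples is expressed by a lower bound \<open>s\<close> with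
  \<open>s k / real k\<close> tending to infinity, capped at \<open>N\<close> because a sample is a
  subset of the data. Superlinear convergence is the little-o relation between consecutive
  errors.\<close>

theorem theorem3:
  fixes M :: "'w measure"
    and N :: nat
    and f :: "nat \<Rightarrow> real^'n \<Rightarrow> real^'m"
    and ell :: "real^'m \<Rightarrow> 'y \<Rightarrow> real"
    and y :: "nat \<Rightarrow> 'y"
    and \<theta>s :: "real^'n"
    and \<theta> :: "nat \<Rightarrow> 'w \<Rightarrow> real^'n"
    and \<Lambda> :: "nat \<Rightarrow> 'w \<Rightarrow> real^'n^'n"
    and S :: "nat \<Rightarrow> 'w \<Rightarrow> nat set"
    and s :: "nat \<Rightarrow> real"
  assumes M: "prob_space M"
    and N: "1 \<le> N"
    and smooth: "\<forall>i\<in>{1..N}. twice_differentiable (sloss ell y i) \<and>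
                   (\<forall>j. twice_differentiable (\<lambda>t. f i t $ j))"
    and samples: "\<forall>k w. S k w \<subseteq> {1..N} \<and> S k w \<noteq> {}"
    and iteration: "\<forall>k w. invertible (sub_ggn (S k w) f ell y (\<theta> k w) + \<Lambda> k w) \<and>
                      \<theta> (Suc k) w = \<theta> k w - matrix_inv (sub_ggn (S k w) f ell y (\<theta> k w) + \<Lambda> k w)
                                        *v grad (objective N f ell y) (\<theta> k w)"
    and bfgs_init: "\<forall>w. transpose (\<Lambda> 0 w) = \<Lambda> 0 w \<and> pos_def (\<Lambda> 0 w)"
    and bfgs_welldef: "\<forall>k w. let u = \<theta> (Suc k) w - \<theta> k w;
                                 v = secant_v (S k w) f ell y (\<theta> k w) (\<theta> (Suc k) w)
                             in u \<bullet> (\<Lambda> k w *v u) \<noteq> 0 \<and> u \<bullet> v \<noteq> 0"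
    and bfgs: "\<forall>k w. let u = \<theta> (Suc k) w - \<theta> k w;
                         v = secant_v (S k w) f ell y (\<theta> k w) (\<theta> (Suc k) w)
                     in \<Lambda> (Suc k) w = \<Lambda> k w
                          - (1 / (u \<bullet> (\<Lambda> k w *v u))) *\<^sub>R outer (\<Lambda> k w *v u) (u v* \<Lambda> k w)
                          + (1 / (u \<bullet> v)) *\<^sub>R outer v v"
    and optimal: "\<forall>t. objective N f ell y \<theta>s \<le> objective N f ell y t"
    and hess_pd: "pos_def (hess (objective N f ell y) \<theta>s)"
    and Pi_lower: "\<exists>lam>0. \<forall>i\<in>{1..N}. loewner_ge (res_part (f i) (sloss ell y i) \<theta>s) (lam *\<^sub>R mat 1)"
    and summable: "AE w in M. summable (\<lambda>k. norm (\<theta> k w - \<theta>s))"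
    and loss_bounds: "\<exists>\<kappa> \<kappa>' L_l r. 0 < r \<and> (\<forall>i\<in>{1..N}.
            (\<forall>t\<in>ball \<theta>s r. norm (grad (sloss ell y i) (f i t)) \<le> \<kappa> \<and>
                             norm (hess (sloss ell y i) (f i t)) \<le> \<kappa>') \<and>
            (\<forall>t1\<in>ball \<theta>s r. \<forall>t2\<in>ball \<theta>s r.
               norm (hess (sloss ell y i) (f i t1) - hess (sloss ell y i) (f i t2)) \<le> L_l * norm (t1 - t2)))"
    and model_bounds: "\<exists>\<kappa> \<kappa>' L_f r. 0 < r \<and> (\<forall>i\<in>{1..N}. \<forall>j.
            (\<forall>t\<in>ball \<theta>s r. norm (grad (\<lambda>z. f i z $ j) t) \<le> \<kappa> \<and> norm (hess (\<lambda>z. f i z $ j) t) \<le> \<kappa>') \<and>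
            (\<forall>t1\<in>ball \<theta>s r. \<forall>t2\<in>ball \<theta>s r.
               norm (hess (\<lambda>z. f i z $ j) t1 - hess (\<lambda>z. f i z $ j) t2) \<le> L_f * norm (t1 - t2)))"
    and superlinear_schedule: "filterlim (\<lambda>k. s k / real k) at_top sequentially"
    and sample_size: "\<forall>k w. min (real N) (s k) \<le> real (card (S k w))"
  shows "AE w in M. (\<lambda>k. \<theta> k w) \<longlonglongrightarrow> \<theta>s \<and>
           (\<lambda>k. norm (\<theta> (Suc k) w - \<theta>s)) \<in> o(\<lambda>k. norm (\<theta> k w - \<theta>s))"
proof -
  \<comment> \<open>Eventually \<open>s k\<close> is at least \<open>k\<close> and \<open>k\<close>
    at least \<open>N\<close>, so the cap is attained and the sample is the whole data set. Positive
    \<open>k\<close> is required since the quotient is 0 by convention at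
    \<open>k = 0\<close>.\<close>
  have full: "\<forall>\<^sub>F k in sequentially. S k w = {1..N}" for w
  proof -
    have "\<forall>\<^sub>F k in sequentially. 1 \<le> s k / real k"
      using superlinear_schedule by (simp add: filterlim_at_top)
    then show ?thesis
      using eventually_ge_at_top[of N] eventually_gt_at_top[of 0]
    proof eventually_elim
      case (elim k)
      have "real N \<le> s k" using elim by (simp add: field_simps)
      then have "card {1..N} \<le> card (S k w)" using sample_size[rule_format, of k w] by simp
      then show ?case using samples by (intro card_seteq) auto
    qed
  qed
  obtain lam where lam: "0 < lam"
    "\<And>i. i \<in> {1..N} \<Longrightarrow> loewner_ge (res_part (f i) (sloss ell y i) \<theta>s) (lam *\<^sub>R mat 1)"
    using Pi_lower by blast
  obtain C r where "0 < r" "\<forall>i\<in>{1..N}. \<forall>t1\<in>ball \<theta>s r. \<forall>t2\<in>ball \<theta>s r.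
      norm (hess (sloss ell y i) (f i t1) - hess (sloss ell y i) (f i t2)) \<le> C * norm (t1 - t2)"
    using loss_bounds by blast
  then have HL: "lipschitz_at (\<lambda>t. hess (sloss ell y i) (f i t)) \<theta>s" if "i \<in> {1..N}" for i
    using that by (intro lipschitz_atI[where C = C]) (auto simp: eventually_nhds_metric dist_commute)
  obtain C' r' where "0 < r'" "\<forall>i\<in>{1..N}. \<forall>j. \<forall>t1\<in>ball \<theta>s r'. \<forall>t2\<in>ball \<theta>s r'.
      norm (hess (\<lambda>z. f i z $ j) t1 - hess (\<lambda>z. f i z $ j) t2) \<le> C' * norm (t1 - t2)"
    using model_bounds by blast
  then have Hf: "lipschitz_at (hess (\<lambda>z. f i z $ j)) \<theta>s" if "i \<in> {1..N}" for i j
    using that by (intro lipschitz_atI[where C = C']) (auto simp: eventually_nhds_metric dist_commute)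
  \<comment> \<open>The rest is deterministic for a fixed outcome \<open>w\<close>; probability
    enters only through the almost sure summability of the errors.\<close>
  have "(\<lambda>k. \<theta> k w) \<longlonglongrightarrow> \<theta>s \<and> (\<lambda>k. norm (\<theta> (Suc k) w - \<theta>s)) \<in> o(\<lambda>k. norm (\<theta> k w - \<theta>s))"
    if w: "summable (\<lambda>k. norm (\<theta> k w - \<theta>s))" for w
  proof
    show "(\<lambda>k. \<theta> k w) \<longlonglongrightarrow> \<theta>s"
      using summable_LIMSEQ_zero[OF w] by (simp add: tendsto_norm_zero_iff LIM_zero_iff)
    have "\<exists>K. \<forall>k\<ge>K. norm (\<theta> (Suc k) w - \<theta>s) \<le> c * norm (\<theta> k w - \<theta>s)" if "0 < c" for c
    proof (rule bfgs_gauss_newton_superlinear[OF N _ _ full, where \<theta> = "\<lambda>k. \<theta> k w" and \<Lambda> = "\<lambda>k. \<Lambda> k w"])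
    qed (use smooth iteration bfgs_init bfgs bfgs_welldef optimal hess_pd lam w HL Hf that in \<open>auto simp: Let_def\<close>)
    then show "(\<lambda>k. norm (\<theta> (Suc k) w - \<theta>s)) \<in> o(\<lambda>k. norm (\<theta> k w - \<theta>s))"
      by (intro landau_o.smallI) (simp add: eventually_sequentially)
  qed
  then show ?thesis
    using summable by (auto elim: eventually_mono)
qed

end
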